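(* Let $n\in\mathbb Z_{>0}$, $u\in S_n$ and $k\in[n]$. Then $(1+\beta x_k)\mathfrak G_u(\mathbf x;\mathbf y)=\sum_\gamma(-1)^p\,(1+\beta y_{u(a_p)})^{-1}\beta^{p+q}\,\mathfrak G_{\mathsf{end}(\gamma)}(\mathbf x;\mathbf y)$, summed over all chains $\gamma$: $u=u_0\to u_1\to\cdots\to u_p\to u_{p+1}\to\cdots\to u_{p+q}=\mathsf{end}(\gamma)$ with $u_i=u_{i-1}(a_i,k)$ for $1\le i\le p$ and $u_{p+i}=u_{p+i-1}(k,b_i)$ for $1\le i\le q$, where $1\le a_p<\cdots<a_1<k<b_q<\cdots<b_1$ are integers, each step increases the length by exactly one, and $a_0:=k$ (so the factor is $(1+\beta y_{u(k)})^{-1}$ when $p=0$). Here $(1+\beta y_i)^{-1}$ denotes the formal inverse.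
   Context: $S_\infty$: finitely supported permutations of $\mathbb Z_{>0}$; $S_n$: those fixing all $i>n$; $\ell(w)$ = number of inversions; $s_i=(i,i+1)$; $w(a,b)$ is $w$ composed on the right with the transposition $(a,b)$. $\beta,x_1,x_2,\dots,y_1,y_2,\dots$ are commuting indeterminates. The double Grothendieck polynomials $\mathfrak G_w(\mathbf x;\mathbf y)\in\mathbb Z[\beta][\mathbf x;\mathbf y]$, $w\in S_\infty$, are the unique elements with (a) $\mathfrak G_{n\cdots321}(\mathbf x;\mathbf y)=\prod_{i,j\in[n-1],\,i+j\le n}(x_i+y_j+\beta x_iy_j)$ for all $n\ge1$ (where $n\cdots321$ is the reversal permutation of $[n]$), and (b) $\mathfrak G_{ws_i}=\pi_i\mathfrak G_w$ whenever $w(i)>w(i+1)$, where $\pi_if=\frac{(1+\beta x_{i+1})f-(1+\beta x_i)s_if}{x_i-x_{i+1}}$ and $s_i$ swaps $x_i$ and $x_{i+1}$. *)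

theory Defs
  imports "HOL-Library.Poly_Mapping" "HOL-Computational_Algebra.Formal_Power_Series"
          "HOL-Combinatorics.Transposition"
begin

definition Sinf :: "(nat \<Rightarrow> nat) set" where
  "Sinf = {w. bij w \<and> w 0 = 0 \<and> finite {i. w i \<noteq> i}}"

definition Sn :: "nat \<Rightarrow> (nat \<Rightarrow> nat) set" where
  "Sn n = {w \<in> Sinf. \<forall>i>n. w i = i}"

definition len :: "(nat \<Rightarrow> nat) \<Rightarrow> nat" where
  "len w = card {(i, j). 0 < i \<and> i < j \<and> w i > w j}"

definition rt :: "(nat \<Rightarrow> nat) \<Rightarrow> nat \<Rightarrow> nat \<Rightarrow> (nat \<Rightarrow> nat)" where
  "rt w a b = w \<circ> transpose a b"

definition w0 :: "nat \<Rightarrow> nat \<Rightarrow> nat" where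
  "w0 n i = (if 1 \<le> i \<and> i \<le> n then n + 1 - i else i)"

text \<open>Variables x_1,x_2,...,y_1,y_2,... ; the polynomial ring Z[x;y] is
  (gvar =>0 nat) =>0 int. The parameter beta is the formal power series variable,
  so the ambient ring is Z[x;y][[beta]], which contains Z[beta][x;y] and in which
  1 + beta*y_i has a formal inverse.\<close>

datatype gvar = X nat | Y nat

type_synonym xypoly = "(gvar \<Rightarrow>\<^sub>0 nat) \<Rightarrow>\<^sub>0 int"
type_synonym gring = "xypoly fps"

definition pvar :: "gvar \<Rightarrow> xypoly" where
  "pvar v = Poly_Mapping.single (Poly_Mapping.single v 1) 1"

definition xv :: "nat \<Rightarrow> gring" where "xv i = fps_const (pvar (X i))"
definition yv :: "nat \<Rightarrow> gring" where "yv j = fps_const (pvar (Y j))"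
definition beta :: gring where "beta = fps_X"

definition swapvar :: "nat \<Rightarrow> gvar \<Rightarrow> gvar" where
  "swapvar i v = (case v of X j \<Rightarrow> X (transpose i (i+1) j) | Y j \<Rightarrow> Y j)"

definition swap_poly :: "nat \<Rightarrow> xypoly \<Rightarrow> xypoly" where
  "swap_poly i p = Poly_Mapping.map_key (Poly_Mapping.map_key (swapvar i)) p"

definition sx :: "nat \<Rightarrow> gring \<Rightarrow> gring" where
  "sx i f = Abs_fps (\<lambda>m. swap_poly i (fps_nth f m))"

definition finv :: "gring \<Rightarrow> gring" where
  "finv f = (THE g. f * g = 1)"

text \<open>Condition (b) is stated in the division-free form
  (x_i - x_(i+1)) G_(w s_i) = (1 + beta x_(i+1)) G_w - (1 + beta x_i) s_i G_w,
  which is the defining equation of pi_i. G is the unique family indexed by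
  S_infinity (extended by 0 outside S_infinity).\<close>

definition is_groth :: "((nat \<Rightarrow> nat) \<Rightarrow> gring) \<Rightarrow> bool" where
  "is_groth G \<longleftrightarrow>
     (\<forall>w. w \<notin> Sinf \<longrightarrow> G w = 0) \<and>
     (\<forall>n\<ge>1. G (w0 n) =
        (\<Prod>(i, j)\<in>{(i, j). 1 \<le> i \<and> i \<le> n - 1 \<and> 1 \<le> j \<and> j \<le> n - 1 \<and> i + j \<le> n}.
           xv i + yv j + beta * xv i * yv j)) \<and>
     (\<forall>w\<in>Sinf. \<forall>i\<ge>1. w i > w (i+1) \<longrightarrow>
        (xv i - xv (i+1)) * G (rt w i (i+1)) =
          (1 + beta * xv (i+1)) * G w - (1 + beta * xv i) * sx i (G w))"

definition groth :: "(nat \<Rightarrow> nat) \<Rightarrow> gring" where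
  "groth = (THE G. is_groth G)"

text \<open>A chain is encoded by the lists as = [a_1,...,a_p] and bs = [b_1,...,b_q].
  Its steps are the transpositions (a_1,k),...,(a_p,k),(k,b_1),...,(k,b_q).\<close>

definition chain_steps :: "nat \<Rightarrow> nat list \<Rightarrow> nat list \<Rightarrow> (nat \<Rightarrow> nat) list" where
  "chain_steps k as bs = map (\<lambda>a. transpose a k) as @ map (\<lambda>b. transpose k b) bs"

definition chain_perm :: "(nat \<Rightarrow> nat) \<Rightarrow> nat \<Rightarrow> nat list \<Rightarrow> nat list \<Rightarrow> nat \<Rightarrow> (nat \<Rightarrow> nat)" where
  "chain_perm u k as bs i = foldl (\<circ>) u (take i (chain_steps k as bs))"

definition chain_end :: "(nat \<Rightarrow> nat) \<Rightarrow> nat \<Rightarrow> nat list \<Rightarrow> nat list \<Rightarrow> (nat \<Rightarrow> nat)" where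
  "chain_end u k as bs = chain_perm u k as bs (length as + length bs)"

definition chains :: "(nat \<Rightarrow> nat) \<Rightarrow> nat \<Rightarrow> (nat list \<times> nat list) set" where
  "chains u k = {(as, bs).
      sorted_wrt (>) as \<and> (\<forall>a\<in>set as. 1 \<le> a \<and> a < k) \<and>
      sorted_wrt (>) bs \<and> (\<forall>b\<in>set bs. k < b) \<and>
      (\<forall>i < length as + length bs.
         len (chain_perm u k as bs (Suc i)) = len (chain_perm u k as bs i) + 1)}"

definition last_a :: "nat \<Rightarrow> nat list \<Rightarrow> nat" where
  "last_a k as = (if as = [] then k else last as)"

end

theory Submission
  imports Defs
begin

text \<open>
  The formula says that multiplication of $G_u$ by $1 + \beta x_k$ is given by an operator
  $M_k = R_k Q_k L_k$ on formal combinations of permutations: with $T_{ab}$ sending $w$ to $w(a,b)$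
  if this raises the length by one and to $0$ otherwise,
  $L_k = (1 - \beta T_{1k}) \cdots (1 - \beta T_{k-1,k})$,
  $R_k = (1 + \beta T_{k,k+1})(1 + \beta T_{k,k+2}) \cdots$, and $Q_k$ scales $w$ by
  $(1 + \beta y_{w(k)})^{-1}$; the last factor is the right weight because $u(a_p)$ is the value at
  position $k$ after the first $p$ steps.
  One inducts downwards on the length, from the longest element of $S_n$, where only two chains
  contribute. On the polynomial side
  $\pi_i (1 + \beta x_i) = (1 + \beta x_{i+1})(\pi_i + \beta)$ and
  $(1 + \beta x_i) \pi_i = (\pi_i + \beta)(1 + \beta x_{i+1})$.
  On the permutation side the nil-Coxeter operator $N_i$, sending $w$ to $w s_i$ if
  $w(i) > w(i+1)$ and to $0$ otherwise, satisfies $T_{ab} N_i = N_i T_{s_i a, s_i b}$ for $(a,b) \neq (i,i+1)$, and the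
  two factors of $M_k$ that $s_i$ interchanges for $k \neq i, i+1$ are put back in order by the
  Yang-Baxter equation for the $1 + \beta T_{ab}$.
\<close>

text \<open>The bridge between the two sides is \<open>descent_op_self\<close>. Applied to G_w, pi_i
  gives G_(w s_i) at a descent i of w and - beta G_w at an ascent, so N_i on G is pi_i on G
  corrected by the factor 1 + beta T_(i,i+1). For k other than i, i + 1 the inductive step carries
  N_i inward through M_k, meets this extra factor at G and carries it back out, where it is inert at
  every w with a descent at i. For k = i and k = i + 1 the factor at (i, i + 1) is absorbed instead,
  and these cases tie M_i to M_(i+1); hence the induction hypothesis covers all k at once. R_k is an
  infinite product, but on S_n no factor beyond T_(k,n+1) acts, so it is cut at n + 1; the base case
  shows that the factor at n + 1 is really needed. Since \<open>groth\<close> is a definite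
  description, existence has to be proved: values on S_n are defined by recursion from the longest
  element and shown to depend neither on the ascents chosen nor on n.\<close>

subsection \<open>The coefficient ring\<close>

text \<open>Any linear order on the variables will do: it makes the coefficient ring an integral domain.\<close>

instantiation gvar :: linorder
begin

fun gvar_code :: "gvar \<Rightarrow> nat" where
  "gvar_code (X i) = 2 * i"
| "gvar_code (Y i) = 2 * i + 1"

definition less_eq_gvar :: "gvar \<Rightarrow> gvar \<Rightarrow> bool" where
  "v \<le> w \<longleftrightarrow> gvar_code v \<le> gvar_code w"

definition less_gvar :: "gvar \<Rightarrow> gvar \<Rightarrow> bool" where
  "v < w \<longleftrightarrow> gvar_code v < gvar_code w"

instance
proof
  fix v w :: gvar
  show "v \<le> w \<Longrightarrow> w \<le> v \<Longrightarrow> v = w"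
    unfolding less_eq_gvar_def by (cases v; cases w; simp; presburger)
qed (auto simp: less_eq_gvar_def less_gvar_def)

end

text \<open>Extending a finite map by a fresh key amounts to adding a monomial, so an additive
  property need only be checked on monomials.\<close>

lemma poly_mapping_add_induct [case_names zero single add]:
  fixes p :: "'a \<Rightarrow>\<^sub>0 'b::comm_monoid_add"
  assumes "P 0" and "\<And>k v. P (Poly_Mapping.single k v)"
    and "\<And>p q. P p \<Longrightarrow> P q \<Longrightarrow> P (p + q)"
  shows "P p"
proof (induction p rule: update_induct)
  case const
  show ?case by (rule assms(1))
next
  case (update p k v)
  have "Poly_Mapping.update k v p = p + Poly_Mapping.single k v"
    using update(1)
    by (intro poly_mapping_eqI) (auto simp: lookup_update lookup_add lookup_single when_def in_keys_iff)
  then show ?case using assms(2,3) update(3) by metis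
qed

text \<open>Constants and variables generate the ring. The additive induction is used twice, on the
  polynomial and on the exponent vector, which is itself a finite map.\<close>

lemma xypoly_induct [case_names const var add mult]:
  fixes p :: xypoly
  assumes const: "\<And>c. P (Poly_Mapping.single 0 c)" and var: "\<And>v. P (pvar v)"
    and add: "\<And>p q. P p \<Longrightarrow> P q \<Longrightarrow> P (p + q)"
    and mult: "\<And>p q. P p \<Longrightarrow> P q \<Longrightarrow> P (p * q)"
  shows "P p"
proof (induction p rule: poly_mapping_add_induct)
  case zero
  show ?case using const[of 0] by simp
next
  case (single m c)
  have "P (Poly_Mapping.single m 1)"
  proof (induction m rule: poly_mapping_add_induct)
    case zero
    show ?case by (rule const)
  next
    case (single v n)
    show ?case
    proof (induction n)
      case 0
      show ?case using const[of 1] by simp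
    next
      case (Suc n)
      have "Poly_Mapping.single (Poly_Mapping.single v (Suc n)) (1::int)
          = pvar v * Poly_Mapping.single (Poly_Mapping.single v n) 1"
        by (simp add: pvar_def mult_single flip: single_add)
      then show ?case using mult[OF var Suc] by simp
    qed
  next
    case (add p q)
    have "Poly_Mapping.single (p + q) (1::int)
        = Poly_Mapping.single p 1 * Poly_Mapping.single q 1"
      by (simp add: mult_single)
    then show ?case using mult[OF add] by simp
  qed
  from mult[OF const[of c] this] show ?case by (simp add: mult_single)
next
  case (add p q)
  then show ?case by (rule assms(3))
qed

section \<open>The adjacent transpositions acting on the coefficient ring\<close>

lemma swapvar_swapvar [simp]: "swapvar i (swapvar i v) = v"
  by (cases v) (auto simp: swapvar_def)

lemma inj_swapvar: "inj (swapvar i)"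
  by (metis injI swapvar_swapvar)

text \<open>\<open>map_key\<close> pulls keys back. For an involution this is the same as pushing
  them forward, so \<open>swap_poly\<close> is indeed substitution of variables.\<close>

lemma map_key_swapvar_single:
  "Poly_Mapping.map_key (swapvar i) (Poly_Mapping.single v c)
    = Poly_Mapping.single (swapvar i v) c"
  using map_key_single[OF inj_swapvar, of i "swapvar i v" c] by simp

lemma map_key_swapvar_swapvar:
  "Poly_Mapping.map_key (swapvar i) (Poly_Mapping.map_key (swapvar i) m) = m"
  using map_key_compose[OF inj_swapvar[of i] inj_swapvar[of i], of m] map_key_id[of m]
  by (simp add: o_def)

lemma inj_map_key_swapvar: "inj (Poly_Mapping.map_key (swapvar i))"
  by (metis injI map_key_swapvar_swapvar)

lemma swap_poly_single:
  "swap_poly i (Poly_Mapping.single m c)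
    = Poly_Mapping.single (Poly_Mapping.map_key (swapvar i) m) c"
  unfolding swap_poly_def
  using map_key_single[OF inj_map_key_swapvar, of i "Poly_Mapping.map_key (swapvar i) m" c]
  by (simp add: map_key_swapvar_swapvar)

lemma swap_poly_add: "swap_poly i (p + q) = swap_poly i p + swap_poly i q"
  unfolding swap_poly_def by (rule map_key_plus[OF inj_map_key_swapvar])

lemma swap_poly_0 [simp]: "swap_poly i 0 = 0"
  using swap_poly_single[of i 0 0] by simp

lemma swap_poly_const [simp]: "swap_poly i (Poly_Mapping.single 0 c) = Poly_Mapping.single 0 c"
  by (simp add: swap_poly_single map_key_zero[OF inj_swapvar])

lemma swap_poly_pvar [simp]: "swap_poly i (pvar v) = pvar (swapvar i v)"
  by (simp add: pvar_def swap_poly_single map_key_swapvar_single)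

lemma swap_poly_mult: "swap_poly i (p * q) = swap_poly i p * swap_poly i q"
proof (induction p rule: poly_mapping_add_induct)
  case (single k c)
  show ?case
    by (induction q rule: poly_mapping_add_induct)
      (simp_all add: mult_single swap_poly_single swap_poly_add distrib_left
         map_key_plus[OF inj_swapvar])
qed (simp_all add: distrib_right swap_poly_add)

lemma swap_poly_sum: "swap_poly i (sum f S) = (\<Sum>x\<in>S. swap_poly i (f x))"
  by (induction S rule: infinite_finite_induct) (simp_all add: swap_poly_add)

lemma sx_nth [simp]: "fps_nth (sx i f) m = swap_poly i (fps_nth f m)"
  by (simp add: sx_def)

lemma sx_add [simp]: "sx i (f + g) = sx i f + sx i g"
  by (rule fps_ext) (simp add: swap_poly_add)

lemma sx_mult [simp]: "sx i (f * g) = sx i f * sx i g"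
  by (rule fps_ext) (simp add: fps_mult_nth swap_poly_sum swap_poly_mult)

lemma sx_const: "sx i (fps_const p) = fps_const (swap_poly i p)"
  by (rule fps_ext) (simp add: fps_const_def)

lemma sx_0 [simp]: "sx i 0 = 0"
  by (rule fps_ext) simp

lemma sx_1 [simp]: "sx i 1 = 1"
  using sx_const[of i 1] swap_poly_const[of i 1] by simp

lemma sx_uminus [simp]: "sx i (- f) = - sx i f"
  using sx_add[of i f "- f"] by (simp add: eq_neg_iff_add_eq_0 add.commute del: sx_add)

lemma sx_diff [simp]: "sx i (f - g) = sx i f - sx i g"
  using sx_add[of i f "- g"] by simp

lemma sx_beta [simp]: "sx i beta = beta"
  using swap_poly_const[of i 1] by (intro fps_ext) (simp add: beta_def fps_X_def)

lemma sx_yv [simp]: "sx i (yv j) = yv j"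
  by (simp add: yv_def sx_const swapvar_def)

lemma sx_xv: "sx i (xv j) = xv (transpose i (i + 1) j)"
  by (simp add: xv_def sx_const swapvar_def)

lemma sx_xv_simps [simp]:
  "sx i (xv i) = xv (Suc i)"
  "sx i (xv (Suc i)) = xv i"
  "j \<noteq> i \<Longrightarrow> j \<noteq> Suc i \<Longrightarrow> sx i (xv j) = xv j"
  by (simp_all add: sx_xv transpose_def)

text \<open>Ring maps are determined on generators. This reduces the Coxeter relations of the swaps
  to a check on single variables.\<close>

lemma swap_poly_relI:
  assumes "\<And>v. \<phi> (pvar v) = \<psi> (pvar v)" "\<And>c. \<phi> (Poly_Mapping.single 0 c)
      = \<psi> (Poly_Mapping.single 0 c)"
    "\<And>p q. \<phi> (p + q) = \<phi> p + \<phi> q" "\<And>p q. \<psi> (p + q) = \<psi> p + \<psi> q"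
    "\<And>p q. \<phi> (p * q) = \<phi> p * \<phi> q" "\<And>p q. \<psi> (p * q) = \<psi> p * \<psi> q"
  shows "\<phi> p = (\<psi> p :: xypoly)"
  by (induction p rule: xypoly_induct) (simp_all add: assms)

lemma sx_sx [simp]: "sx i (sx i f) = f"
proof -
  have "swap_poly i (swap_poly i p) = p" for p
    by (rule swap_poly_relI[where \<phi> = "\<lambda>p. swap_poly i (swap_poly i p)" and \<psi> = "\<lambda>p. p"])
      (simp_all add: swap_poly_add swap_poly_mult)
  then show ?thesis by (intro fps_ext) simp
qed

lemma sx_commute:
  assumes "j > Suc i"
  shows "sx i (sx j f) = sx j (sx i f)"
proof -
  have "swap_poly i (swap_poly j p) = swap_poly j (swap_poly i p)" for p
  proof (rule swap_poly_relI[where \<phi> = "\<lambda>p. swap_poly i (swap_poly j p)"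
        and \<psi> = "\<lambda>p. swap_poly j (swap_poly i p)"])
    fix v
    show "swap_poly i (swap_poly j (pvar v)) = swap_poly j (swap_poly i (pvar v))"
      using assms by (cases v) (auto simp: swapvar_def transpose_def)
  qed (simp_all add: swap_poly_add swap_poly_mult)
  then show ?thesis by (intro fps_ext) simp
qed

lemma sx_braid: "sx i (sx (Suc i) (sx i f)) = sx (Suc i) (sx i (sx (Suc i) f))"
proof -
  have "swap_poly i (swap_poly (Suc i) (swap_poly i p))
      = swap_poly (Suc i) (swap_poly i (swap_poly (Suc i) p))" for p
  proof (rule swap_poly_relI[where \<phi> = "\<lambda>p. swap_poly i (swap_poly (Suc i) (swap_poly i p))"
        and \<psi> = "\<lambda>p. swap_poly (Suc i) (swap_poly i (swap_poly (Suc i) p))"])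
    fix v
    show "swap_poly i (swap_poly (Suc i) (swap_poly i (pvar v)))
        = swap_poly (Suc i) (swap_poly i (swap_poly (Suc i) (pvar v)))"
      by (cases v) (auto simp: swapvar_def transpose_def)
  qed (simp_all add: swap_poly_add swap_poly_mult)
  then show ?thesis by (intro fps_ext) simp
qed

text \<open>The coefficient ring is a domain, so such differences can be cancelled; every division
  by x_i - x_j below is such a cancellation.\<close>

lemma xv_neq: "i \<noteq> j \<Longrightarrow> xv i - xv j \<noteq> 0"
proof
  assume "i \<noteq> j" and "xv i - xv j = 0"
  then have "pvar (X i) = pvar (X j)"
    by (simp add: xv_def)
  then have "Poly_Mapping.single (X i) (1::nat) = Poly_Mapping.single (X j) 1"
    unfolding pvar_def by (metis lookup_single_eq lookup_single_not_eq zero_neq_one)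
  then have "X i = X j"
    by (metis lookup_single_eq lookup_single_not_eq zero_neq_one)
  with \<open>i \<noteq> j\<close> show False by simp
qed

text \<open>Divisibility holds on generators and passes to products by the twisted Leibniz rule. For
  power series the quotients are chosen coefficient by coefficient.\<close>

lemma xv_diff_dvd: "xv i - xv (Suc i) dvd f - sx i f"
proof -
  have dvd: "pvar (X i) - pvar (X (Suc i)) dvd p - swap_poly i p" for p
  proof (induction p rule: xypoly_induct)
    case (const c)
    show ?case by simp
  next
    case (var v)
    have "\<exists>c. pvar v - pvar (swapvar i v) = (pvar (X i) - pvar (X (Suc i))) * c"
    proof (cases v)
      case (X j)
      consider "j = i" | "j = Suc i" | "j \<noteq> i" "j \<noteq> Suc i" by blast
      then show ?thesis
      proof cases
        case 1
        then show ?thesis using X by (intro exI[of _ 1]) (simp add: swapvar_def)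
      next
        case 2
        then show ?thesis using X by (intro exI[of _ "- 1"]) (simp add: swapvar_def)
      next
        case 3
        then show ?thesis using X by (intro exI[of _ 0]) (simp add: swapvar_def)
      qed
    next
      case (Y j)
      then show ?thesis by (intro exI[of _ 0]) (simp add: swapvar_def)
    qed
    then show ?case by (auto simp: dvd_def)
  next
    case (add p q)
    from dvd_add[OF this] show ?case by (simp add: swap_poly_add algebra_simps)
  next
    case (mult p q)
    have "p * q - swap_poly i (p * q)
        = (p - swap_poly i p) * q + swap_poly i p * (q - swap_poly i q)"
      by (simp add: swap_poly_mult algebra_simps)
    then show ?case using mult by simp
  qed
  then have "\<forall>m. \<exists>c. fps_nth f m - swap_poly i (fps_nth f m)
      = (pvar (X i) - pvar (X (Suc i))) * c"
    by (auto simp: dvd_def)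
  then obtain c where c: "\<And>m. fps_nth f m - swap_poly i (fps_nth f m)
      = (pvar (X i) - pvar (X (Suc i))) * c m"
    by metis
  have "f - sx i f = (xv i - xv (Suc i)) * Abs_fps c"
    unfolding xv_def fps_const_sub by (rule fps_ext) (simp add: c)
  then show ?thesis by simp
qed

lemma finv_eqI: "f * g = 1 \<Longrightarrow> finv f = g"
  unfolding finv_def
proof (rule the_equality)
  fix h assume "f * g = 1" "f * h = 1"
  have "h = (f * g) * h" unfolding \<open>f * g = 1\<close> by simp
  also have "\<dots> = (f * h) * g" by (simp only: mult.assoc mult.commute[of g h])
  finally show "h = g" unfolding \<open>f * h = 1\<close> by simp
qed

lemma finv_mult: "(1 + beta * yv j) * finv (1 + beta * yv j) = 1"
proof -
  \<comment> \<open>The geometric series in beta with ratio - beta y_j.\<close>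
  define g where "g = Abs_fps (\<lambda>m. (- pvar (Y j)) ^ m)"
  have "(1 + beta * yv j) * g = 1"
  proof (rule fps_ext)
    fix m
    have "(1 + beta * yv j) * g = g + fps_X * (fps_const (pvar (Y j)) * g)"
      by (simp add: beta_def yv_def algebra_simps)
    then show "fps_nth ((1 + beta * yv j) * g) m = fps_nth 1 m"
      by (cases m) (simp_all add: g_def)
  qed
  then show ?thesis using finv_eqI by metis
qed

lemma sx_finv [simp]: "sx i (finv (1 + beta * yv j)) = finv (1 + beta * yv j)"
proof -
  have "sx i ((1 + beta * yv j) * finv (1 + beta * yv j)) = sx i 1"
    by (simp only: finv_mult)
  then have "(1 + beta * yv j) * sx i (finv (1 + beta * yv j)) = 1"
    by simp
  then show ?thesis by (rule finv_eqI[symmetric])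
qed

subsection \<open>Isobaric divided differences\<close>

definition ddiff :: "nat \<Rightarrow> gring \<Rightarrow> gring" where
  "ddiff i f = (THE g. (xv i - xv (Suc i)) * g
     = (1 + beta * xv (Suc i)) * f - (1 + beta * xv i) * sx i f)"

lemma ddiff_eqI:
  "(xv i - xv (Suc i)) * g = (1 + beta * xv (Suc i)) * f - (1 + beta * xv i) * sx i f
    \<Longrightarrow> ddiff i f = g"
  unfolding ddiff_def
proof (rule the_equality)
  fix h assume "(xv i - xv (Suc i)) * g = (1 + beta * xv (Suc i)) * f - (1 + beta * xv i) * sx i f"
    and "(xv i - xv (Suc i)) * h = (1 + beta * xv (Suc i)) * f - (1 + beta * xv i) * sx i f"
  then show "h = g"
    using xv_neq[of i "Suc i"] by (metis mult_cancel_left n_not_Suc_n)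
qed

lemma ddiff: "(xv i - xv (Suc i)) * ddiff i f
    = (1 + beta * xv (Suc i)) * f - (1 + beta * xv i) * sx i f"
proof -
  obtain c where c: "f - sx i f = (xv i - xv (Suc i)) * c"
    using xv_diff_dvd by (auto simp: dvd_def)
  \<comment> \<open>The numerator equals (1 + beta x_i)(f - s_i f) - beta (x_i - x_(i+1)) f, which
    dictates this quotient.\<close>
  have "(xv i - xv (Suc i)) * (c * (1 + beta * xv i) - beta * f)
      = (f - sx i f) * (1 + beta * xv i) - (xv i - xv (Suc i)) * (beta * f)"
    unfolding c by (simp add: algebra_simps)
  also have "\<dots> = (1 + beta * xv (Suc i)) * f - (1 + beta * xv i) * sx i f"
    by (simp add: algebra_simps)
  finally show ?thesis using ddiff_eqI by metis
qed

lemma ddiff_add: "ddiff i (f + g) = ddiff i f + ddiff i g"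
proof (rule ddiff_eqI)
  show "(xv i - xv (Suc i)) * (ddiff i f + ddiff i g)
      = (1 + beta * xv (Suc i)) * (f + g) - (1 + beta * xv i) * sx i (f + g)"
    unfolding distrib_left[of "xv i - xv (Suc i)"] ddiff by (simp add: algebra_simps)
qed

lemma ddiff_scale: "sx i c = c \<Longrightarrow> ddiff i (c * f) = c * ddiff i f"
proof (rule ddiff_eqI)
  assume "sx i c = c"
  then show "(xv i - xv (Suc i)) * (c * ddiff i f)
      = (1 + beta * xv (Suc i)) * (c * f) - (1 + beta * xv i) * sx i (c * f)"
    unfolding mult.left_commute[of "xv i - xv (Suc i)" c] ddiff by (simp add: algebra_simps)
qed

lemma ddiff_0 [simp]: "ddiff i 0 = 0"
  by (rule ddiff_eqI) simp

text \<open>Numerator and denominator of pi_i both change sign under s_i.\<close>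

lemma sx_ddiff [simp]: "sx i (ddiff i f) = ddiff i f"
proof -
  have "sx i ((xv i - xv (Suc i)) * ddiff i f)
      = sx i ((1 + beta * xv (Suc i)) * f - (1 + beta * xv i) * sx i f)"
    by (simp only: ddiff)
  then have "(xv i - xv (Suc i)) * sx i (ddiff i f)
      = (1 + beta * xv (Suc i)) * f - (1 + beta * xv i) * sx i f"
    by (simp add: algebra_simps)
  from ddiff_eqI[OF this] show ?thesis by simp
qed

lemma ddiff_1: "ddiff i 1 = - beta"
  by (rule ddiff_eqI) (simp add: algebra_simps)

text \<open>Being symmetric, \<open>ddiff i f\<close> is a scalar for pi_i, and pi_i 1 = - beta.
  This fixes the effect of pi_i at ascents.\<close>

lemma ddiff_ddiff: "ddiff i (ddiff i f) = - beta * ddiff i f"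
  using ddiff_scale[of i "ddiff i f" 1] by (simp add: ddiff_1 mult.commute)

text \<open>This relation serves k = i + 1 in the inductive step; \<open>ddiff_mult_right\<close>
  serves k = i.\<close>

lemma ddiff_mult_left: "ddiff i ((1 + beta * xv i) * f)
    = (1 + beta * xv (Suc i)) * (ddiff i f + beta * f)"
proof (rule ddiff_eqI)
  have "(xv i - xv (Suc i)) * ((1 + beta * xv (Suc i)) * (ddiff i f + beta * f))
      = (1 + beta * xv (Suc i)) * ((xv i - xv (Suc i)) * ddiff i f + (xv i - xv (Suc i)) * beta
          * f)"
    by (simp add: algebra_simps)
  then show "(xv i - xv (Suc i)) * ((1 + beta * xv (Suc i)) * (ddiff i f + beta * f))
      = (1 + beta * xv (Suc i)) * ((1 + beta * xv i) * f)
        - (1 + beta * xv i) * sx i ((1 + beta * xv i) * f)"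
    by (simp only: ddiff) (simp add: algebra_simps)
qed

lemma ddiff_mult_right: "ddiff i ((1 + beta * xv (Suc i)) * f) + beta * ((1 + beta * xv (Suc i))
    * f)
    = (1 + beta * xv i) * ddiff i f"
proof -
  have "ddiff i ((1 + beta * xv (Suc i)) * f)
      = (1 + beta * xv i) * ddiff i f - beta * ((1 + beta * xv (Suc i)) * f)"
  proof (rule ddiff_eqI)
    have "(xv i - xv (Suc i)) * ((1 + beta * xv i) * ddiff i f - beta * ((1 + beta * xv (Suc i))
        * f))
      = (1 + beta * xv i) * ((xv i - xv (Suc i)) * ddiff i f)
        - (xv i - xv (Suc i)) * (beta * ((1 + beta * xv (Suc i)) * f))"
      by (simp add: algebra_simps)
    then show "(xv i - xv (Suc i)) * ((1 + beta * xv i) * ddiff i f - beta * ((1 + beta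
        * xv (Suc i)) * f))
      = (1 + beta * xv (Suc i)) * ((1 + beta * xv (Suc i)) * f)
        - (1 + beta * xv i) * sx i ((1 + beta * xv (Suc i)) * f)"
      by (simp only: ddiff) (simp add: algebra_simps)
  qed
  then show ?thesis by simp
qed

text \<open>Each denominator is invariant under the other swap, so both can be moved inside and
  cleared together.\<close>

lemma ddiff_commute:
  assumes "Suc i < j"
  shows "ddiff i (ddiff j f) = ddiff j (ddiff i f)"
proof -
  define d e where "d = xv i - xv (Suc i)" and "e = xv j - xv (Suc j)"
  have nz: "d * e \<noteq> 0"
    using xv_neq[of i "Suc i"] xv_neq[of j "Suc j"] by (simp add: d_def e_def)
  have inv: "sx i e = e" "sx j d = d" "sx i (xv j) = xv j" "sx i (xv (Suc j)) = xv (Suc j)"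
    "sx j (xv i) = xv i" "sx j (xv (Suc i)) = xv (Suc i)"
    using assms by (simp_all add: d_def e_def)
  have "d * (e * ddiff i (ddiff j f)) = d * ddiff i (e * ddiff j f)"
    using inv(1) by (simp add: ddiff_scale)
  also have "\<dots> = e * ddiff j (d * ddiff i f)"
    unfolding d_def e_def ddiff using inv(3-6) sx_commute[OF assms, of f]
        by (simp add: algebra_simps)
  also have "\<dots> = e * (d * ddiff j (ddiff i f))"
    using inv(2) by (simp add: ddiff_scale)
  finally have "(d * e) * ddiff i (ddiff j f) = (d * e) * ddiff j (ddiff i f)"
    by (simp only: mult.assoc mult.left_commute[of e d])
  then show ?thesis
    using nz by (metis mult_cancel_left)
qed

text \<open>The braid relation with denominators cleared. The six images of f under the group
  generated by the two swaps are treated as independent unknowns, so it becomes a plain polynomial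
  identity.\<close>

lemma braid_identity:
  fixes a b c t f f1 f2 f12 f21 f121 :: "'a::comm_ring_1"
  defines "A \<equiv> 1 + t * a" and "B \<equiv> 1 + t * b" and "C \<equiv> 1 + t * c"
  shows "(b - c) * (B * (C * (a - c) * (B * f - A * f1) - B * (a - b) * (C * f2 - A * f21))
           + A * (C * (b - c) * (A * f1 - B * f) - A * (b - a) * (C * f12 - B * f121)))
       = (a - b) * (C * (B * (a - c) * (C * f - B * f2) - A * (b - c) * (C * f1 - A * f12))
           + B * (C * (a - b) * (B * f2 - C * f) - A * (c - b) * (B * f21 - A * f121)))"
  unfolding A_def B_def C_def by (simp add: algebra_simps)

lemma ddiff_braid:
  "ddiff i (ddiff (Suc i) (ddiff i f)) = ddiff (Suc i) (ddiff i (ddiff (Suc i) f))"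
proof -
  define a b c where abc: "a = xv i" "b = xv (Suc i)" "c = xv (Suc (Suc i))"
  define A B C where ABC: "A = 1 + beta * a" "B = 1 + beta * b" "C = 1 + beta * c"
  define s s' where s: "s = sx i" "s' = sx (Suc i)"
  have sv [simp]: "s a = b" "s b = a" "s c = c" "s' a = a" "s' b = c" "s' c = b"
    by (simp_all add: abc s)
  have hom [simp]: "s (g + h) = s g + s h" "s (g - h) = s g - s h" "s (g * h) = s g * s h"
     "s' (g + h) = s' g + s' h" "s' (g - h) = s' g - s' h" "s' (g * h) = s' g * s' h"
     "s (s g) = g" "s' (s' g) = g" for g h
    by (simp_all add: s)
  have sV [simp]: "s A = B" "s B = A" "s C = C" "s' A = A" "s' B = C" "s' C = B"
    by (simp_all add: abc s ABC)
  have braid: "s (s' (s f)) = s' (s (s' f))"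
    by (simp add: s sx_braid)
  have p: "(a - b) * ddiff i g = B * g - A * s g" "(b - c) * ddiff (Suc i) g = C * g - B * s' g"
      for g
    unfolding abc ABC s by (rule ddiff)+
  have nz: "a - b \<noteq> 0" "b - c \<noteq> 0" "a - c \<noteq> 0"
    unfolding abc by (rule xv_neq; simp)+
  \<comment> \<open>The Vandermonde product of the three variables clears the denominators of a
    twofold composite. It is antisymmetric, so it passes through either swap at the cost of a
    sign.\<close>
  define V where "V = (b - c) * ((a - b) * (a - c))"
  have sV_V: "s V = - V" "s' V = - V"
    by (simp_all add: V_def algebra_simps)
  define W where "W = C * (a - c) * (B * f - A * s f) - B * (a - b) * (C * s' f - A * s' (s f))"
  define W' where "W' = B * (a - c) * (C * f - B * s' f) - A * (b - c) * (C * s f - A * s (s' f))"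
  have W: "V * ddiff (Suc i) (ddiff i f) = W"
  proof -
    have "((a - b) * (a - c)) * ddiff (Suc i) (ddiff i f)
        = ddiff (Suc i) ((a - b) * (a - c) * ddiff i f)"
      by (rule ddiff_scale[symmetric]) (simp add: mult.commute flip: s)
    also have "(a - b) * (a - c) * ddiff i f = (a - c) * ((a - b) * ddiff i f)"
      by (simp only: mult.assoc mult.left_commute)
    finally have "V * ddiff (Suc i) (ddiff i f)
        = (b - c) * ddiff (Suc i) ((a - c) * ((a - b) * ddiff i f))"
      unfolding V_def by (simp only: mult.assoc)
    then show ?thesis unfolding p W_def by (simp add: algebra_simps)
  qed
  have W': "V * ddiff i (ddiff (Suc i) f) = W'"
  proof -
    have "((b - c) * (a - c)) * ddiff i (ddiff (Suc i) f)
        = ddiff i ((b - c) * (a - c) * ddiff (Suc i) f)"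
      by (rule ddiff_scale[symmetric]) (simp add: mult.commute flip: s)
    also have "(b - c) * (a - c) * ddiff (Suc i) f = (a - c) * ((b - c) * ddiff (Suc i) f)"
      by (simp only: mult.assoc mult.left_commute)
    finally have "V * ddiff i (ddiff (Suc i) f)
        = (a - b) * ddiff i ((a - c) * ((b - c) * ddiff (Suc i) f))"
      unfolding V_def by (simp only: mult.assoc mult.left_commute)
    then show ?thesis unfolding p W'_def by (simp add: algebra_simps)
  qed
  have sW: "V * s (ddiff (Suc i) (ddiff i f)) = - s W" "V * s' (ddiff i (ddiff (Suc i) f))
      = - s' W'"
    using sV_V by (simp_all flip: W W')
  have H: "V * ((a - b) * ddiff i (ddiff (Suc i) (ddiff i f))) = B * W + A * s W"
  proof -
    have "V * ((a - b) * ddiff i (ddiff (Suc i) (ddiff i f)))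
        = B * (V * ddiff (Suc i) (ddiff i f)) - A * (V * s (ddiff (Suc i) (ddiff i f)))"
      unfolding p by (simp only: right_diff_distrib mult.left_commute)
    then show ?thesis unfolding W sW by simp
  qed
  have H': "V * ((b - c) * ddiff (Suc i) (ddiff i (ddiff (Suc i) f))) = C * W' + B * s' W'"
  proof -
    have "V * ((b - c) * ddiff (Suc i) (ddiff i (ddiff (Suc i) f)))
        = C * (V * ddiff i (ddiff (Suc i) f)) - B * (V * s' (ddiff i (ddiff (Suc i) f)))"
      unfolding p by (simp only: right_diff_distrib mult.left_commute)
    then show ?thesis unfolding W' sW by simp
  qed
  have "(b - c) * (B * W + A * s W) = (a - b) * (C * W' + B * s' W')"
    unfolding W_def W'_def hom sv sV braid unfolding ABC
    by (rule braid_identity)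
  then have "(V * (a - b) * (b - c)) * ddiff i (ddiff (Suc i) (ddiff i f))
      = (V * (a - b) * (b - c)) * ddiff (Suc i) (ddiff i (ddiff (Suc i) f))"
    unfolding H[symmetric] H'[symmetric] by (simp only: mult.assoc mult.left_commute)
  moreover have "V * (a - b) * (b - c) \<noteq> 0"
    using nz by (simp add: V_def)
  ultimately show ?thesis by (metis mult_cancel_left)
qed

subsection \<open>Length and covers in the Bruhat order\<close>

lemma rt_apply: "rt w a b i = w (transpose a b i)"
  by (simp add: rt_def)

lemma rt_eqs [simp]:
  "rt w a b a = w b" "rt w a b b = w a" "i \<noteq> a \<Longrightarrow> i \<noteq> b \<Longrightarrow> rt w a b i = w i"
  by (simp_all add: rt_def)

lemma rt_rt [simp]: "rt (rt w a b) a b = w"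
  by (simp add: rt_def fun_eq_iff)

lemma rt_commute: "a \<noteq> c \<Longrightarrow> a \<noteq> d \<Longrightarrow> b \<noteq> c \<Longrightarrow> b \<noteq> d \<Longrightarrow> rt (rt w a b) c d = rt (rt w c d) a b"
  by (auto simp: rt_def fun_eq_iff transpose_def)

lemma inj_rt [simp]: "inj (rt w a b) \<longleftrightarrow> inj w"
proof -
  have "inj w \<Longrightarrow> inj (rt w a b)" for w :: "nat \<Rightarrow> nat"
    unfolding rt_def by (intro inj_compose) auto
  from this[of w] this[of "rt w a b"] show ?thesis by auto
qed

lemma Sinf_inj: "w \<in> Sinf \<Longrightarrow> inj w"
  by (simp add: Sinf_def bij_is_inj)

lemma Sn_Sinf: "w \<in> Sn n \<Longrightarrow> w \<in> Sinf"
  by (simp add: Sn_def)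

lemma Sn_inj: "w \<in> Sn n \<Longrightarrow> inj w"
  using Sn_Sinf Sinf_inj by blast

lemma Sn_fix: "w \<in> Sn n \<Longrightarrow> n < i \<Longrightarrow> w i = i"
  by (simp add: Sn_def)

lemma Sn_mono: "w \<in> Sn m \<Longrightarrow> m \<le> n \<Longrightarrow> w \<in> Sn n"
  by (simp add: Sn_def)

lemma Sinf_Sn: "w \<in> Sinf \<Longrightarrow> \<exists>n. w \<in> Sn n"
proof -
  assume w: "w \<in> Sinf"
  then have fin: "finite {i. w i \<noteq> i}" by (simp add: Sinf_def)
  have "w i = i" if "i > Max (insert 0 {i. w i \<noteq> i})" for i
  proof (rule ccontr)
    assume "w i \<noteq> i"
    then have "i \<le> Max (insert 0 {i. w i \<noteq> i})"
      using fin by (intro Max_ge) auto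
    with that show False by simp
  qed
  with w show ?thesis unfolding Sn_def by blast
qed

lemma Sn_image: "w \<in> Sn n \<Longrightarrow> i \<le> n \<Longrightarrow> w i \<le> n"
  by (metis Sn_fix Sn_inj injD not_le)

lemma Sinf_pos: "w \<in> Sinf \<Longrightarrow> 0 < i \<Longrightarrow> 0 < w i"
  by (metis (mono_tags, lifting) Sinf_def Sinf_inj injD mem_Collect_eq not_gr_zero)

lemma Sinf_rt: "w \<in> Sinf \<Longrightarrow> 0 < a \<Longrightarrow> 0 < b \<Longrightarrow> rt w a b \<in> Sinf"
proof -
  assume w: "w \<in> Sinf" and ab: "0 < a" "0 < b"
  have "{i. rt w a b i \<noteq> i} \<subseteq> {a, b} \<union> {i. w i \<noteq> i}"
    by (auto simp: rt_apply transpose_def split: if_splits)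
  then have "finite {i. rt w a b i \<noteq> i}"
    by (rule finite_subset) (use w in \<open>simp add: Sinf_def\<close>)
  then show ?thesis
    using w ab by (simp add: Sinf_def) (simp add: rt_def bij_comp)
qed

lemma Sn_rt: "w \<in> Sn n \<Longrightarrow> 0 < a \<Longrightarrow> 0 < b \<Longrightarrow> a \<le> n \<Longrightarrow> b \<le> n \<Longrightarrow> rt w a b \<in> Sn n"
  by (auto simp: Sn_def Sinf_rt)

lemma Sinf_rt_iff: "0 < a \<Longrightarrow> 0 < b \<Longrightarrow> rt w a b \<in> Sinf \<longleftrightarrow> w \<in> Sinf"
  by (metis Sinf_rt rt_rt)

lemma w0_Sn [simp]: "w0 n \<in> Sn n"
proof -
  have inv: "w0 n (w0 n i) = i" for i by (auto simp: w0_def)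
  have "bij (w0 n)" by (rule o_bij[of "w0 n"]) (auto simp: inv)
  moreover have "{i. w0 n i \<noteq> i} \<subseteq> {..n}" by (auto simp: w0_def)
  then have "finite {i. w0 n i \<noteq> i}" by (rule finite_subset) simp
  ultimately show ?thesis by (simp add: Sn_def Sinf_def) (simp add: w0_def)
qed

lemma finite_inversions: "w \<in> Sn n \<Longrightarrow> {(i, j). 0 < i \<and> i < j \<and> w i > w j} \<subseteq> {1..n} \<times> {1..n}"
proof clarify
  fix i j assume w: "w \<in> Sn n" and ij: "0 < i" "i < j" "w j < w i"
  have "j \<le> n"
  proof (rule ccontr)
    assume "\<not> j \<le> n"
    then have "i \<le> n" using ij w by (metis Sn_fix not_le order.asym)
    then show False using Sn_image[OF w] Sn_fix[OF w, of j] \<open>\<not> j \<le> n\<close> ij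
      by (metis less_le_trans not_le order.asym)
  qed
  then show "i \<in> {1..n} \<and> j \<in> {1..n}" using ij by auto
qed

lemma len_le: "w \<in> Sn n \<Longrightarrow> len w \<le> n * n"
  unfolding len_def using card_mono[OF _ finite_inversions] by fastforce

text \<open>Applying s_i to both positions matches the inversions of w with those of w s_i other
  than (i, i + 1) itself.\<close>

lemma len_rt_ascent:
  assumes "w \<in> Sinf" "0 < i" "w i < w (Suc i)"
  shows "len (rt w i (Suc i)) = len w + 1"
proof -
  let ?t = "transpose i (Suc i)"
  let ?I = "\<lambda>w. {(j, k). 0 < j \<and> j < k \<and> (w k::nat) < w j}"
  have fin: "finite (?I w)"
    using Sinf_Sn[OF assms(1)] finite_inversions finite_subset by blast
  have tpos: "0 < ?t j \<longleftrightarrow> 0 < j" for j using assms(2) by (auto simp: transpose_def)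
  have tless: "?t j < ?t k \<longleftrightarrow> j < k" if "(j, k) \<noteq> (i, Suc i)" "(j, k) \<noteq> (Suc i, i)" for j k
    using that by (auto simp: transpose_def)
  have "?I (rt w i (Suc i)) = insert (i, Suc i) ((\<lambda>(j, k). (?t j, ?t k)) ` ?I w)" (is "?L = ?R")
  proof (intro set_eqI iffI)
    fix p assume p: "p \<in> ?L"
    show "p \<in> ?R"
    proof (cases "p = (i, Suc i)")
      case False
      obtain j k where [simp]: "p = (j, k)" by force
      have "(?t j, ?t k) \<in> ?I w"
        using p False tless[of j k] tpos by (auto simp: rt_apply)
      then have "p \<in> (\<lambda>(j, k). (?t j, ?t k)) ` ?I w"
        by (intro image_eqI[where x = "(?t j, ?t k)"]) simp_all
      then show ?thesis by simp
    qed simp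
  next
    fix p assume "p \<in> ?R"
    then show "p \<in> ?L"
    proof
      assume "p = (i, Suc i)"
      then show ?thesis using assms by simp
    next
      assume "p \<in> (\<lambda>(j, k). (?t j, ?t k)) ` ?I w"
      then obtain j k where "p = (?t j, ?t k)" "(j, k) \<in> ?I w" by auto
      moreover from this have "(j, k) \<noteq> (i, Suc i)" using assms(3) by auto
      ultimately show ?thesis
        using tless[of j k] tpos by (auto simp: rt_apply)
    qed
  qed
  moreover have "(i, Suc i) \<notin> (\<lambda>(j, k). (?t j, ?t k)) ` ?I w"
    by (auto simp: transpose_def split: if_splits)
  moreover have "inj_on (\<lambda>(j, k). (?t j, ?t k)) (?I w)"
    by (auto intro!: inj_onI dest: injD[OF inj_on_transpose])
  ultimately show ?thesis
    using fin unfolding len_def by (simp add: card_image)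
qed

lemma len_rt_descent:
  assumes "w \<in> Sinf" "0 < i" "w i > w (Suc i)"
  shows "len w = len (rt w i (Suc i)) + 1"
  using len_rt_ascent[of "rt w i (Suc i)" i] assms Sinf_rt by simp

text \<open>The swap of a and b + 1 is the swap of a and b conjugated by the adjacent swap at b. The
  two outer swaps cancel in length unless w b lies between the two exchanged values; then both raise
  it, which is the contribution 2 of position b.\<close>

lemma len_rt:
  assumes "w \<in> Sinf" "0 < a" "w a < w (a + Suc d)"
  shows "len (rt w a (a + Suc d))
    = len w + 1 + 2 * card {c. a < c \<and> c < a + Suc d \<and> w a < w c \<and> w c < w (a + Suc d)}"
  using assms
proof (induction d arbitrary: w)
  case 0
  have "{c. a < c \<and> c < a + Suc 0 \<and> w a < w c \<and> w c < w (a + Suc 0)} = {}" by auto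
  with len_rt_ascent[OF 0(1,2)] 0(3) show ?case by simp
next
  case (Suc d)
  define b where "b = a + Suc d"
  define v where "v = rt w b (Suc b)"
  let ?C = "{c. a < c \<and> c < b \<and> w a < w c \<and> w c < w (Suc b)}"
  have ab: "a < b" "0 < b" by (auto simp: b_def)
  have v: "v \<in> Sinf" using Suc.prems ab by (simp add: v_def Sinf_rt)
  have va: "v a = w a" "v b = w (Suc b)" "v (Suc b) = w b" using ab by (auto simp: v_def)
  have lt: "w a < w (Suc b)" using Suc.prems by (simp add: b_def)
  have "{c. a < c \<and> c < b \<and> v a < v c \<and> v c < v b} = ?C"
    using va by (auto simp: v_def)
  with Suc.IH[OF v Suc.prems(2)] va lt
  have IH: "len (rt v a b) = len v + 1 + 2 * card ?C" by (simp add: b_def)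
  have vab: "rt v a b \<in> Sinf" using v ab Suc.prems by (simp add: Sinf_rt)
  have eq: "rt w a (Suc b) = rt (rt v a b) b (Suc b)"
    using ab by (auto simp: v_def rt_def fun_eq_iff transpose_def)
  have vals: "rt v a b b = w a" "rt v a b (Suc b) = w b" using va ab by auto
  have fin: "finite ?C" by simp
  let ?D = "{c. a < c \<and> c < Suc b \<and> w a < w c \<and> w c < w (Suc b)}"
  have inj: "inj w" using Suc.prems(1) by (rule Sinf_inj)
  then have ne: "w b \<noteq> w a" "w b \<noteq> w (Suc b)" using ab inj by (simp_all add: inj_eq)
  consider "w b < w a" | "w a < w b" "w b < w (Suc b)" | "w (Suc b) < w b"
    using ne by linarith
  then have "len (rt w a (Suc b)) = len w + 1 + 2 * card ?D"
  proof cases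
    case 1
    then have "?D = ?C" by (auto simp: less_Suc_eq)
    moreover have "len v = len w + 1"
      unfolding v_def using 1 lt ab Suc.prems by (intro len_rt_ascent) auto
    moreover have "len (rt v a b) = len (rt w a (Suc b)) + 1"
      unfolding eq using 1 vals vab ab by (intro len_rt_descent) auto
    ultimately show ?thesis using IH by simp
  next
    case 2
    then have "?D = insert b ?C" using ab by (auto simp: less_Suc_eq)
    then have "card ?D = Suc (card ?C)" by simp
    moreover have "len v = len w + 1"
      unfolding v_def using 2 ab Suc.prems by (intro len_rt_ascent) auto
    moreover have "len (rt w a (Suc b)) = len (rt v a b) + 1"
      unfolding eq using 2 vals vab ab by (intro len_rt_ascent) auto
    ultimately show ?thesis using IH by simp
  next
    case 3
    then have "?D = ?C" by (auto simp: less_Suc_eq)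
    moreover have "len w = len v + 1"
      unfolding v_def using 3 ab Suc.prems by (intro len_rt_descent) auto
    moreover have "len (rt w a (Suc b)) = len (rt v a b) + 1"
      unfolding eq using 3 lt vals vab ab by (intro len_rt_ascent) auto
    ultimately show ?thesis using IH by simp
  qed
  then show ?case by (simp add: b_def)
qed

text \<open>The length condition in local form. It makes sense for every map, not only in
  \<open>Sinf\<close>, so operator identities can be stated as equations of functions; at a map that
  is not injective all Bruhat factors are trivial.\<close>

definition cov :: "(nat \<Rightarrow> nat) \<Rightarrow> nat \<Rightarrow> nat \<Rightarrow> bool" where
  "cov w a b \<longleftrightarrow> inj w \<and> a < b \<and> w a < w b \<and> (\<forall>c. a < c \<and> c < b \<longrightarrow> \<not> (w a < w c \<and> w c < w b))"

lemma cov_iff_len: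
  assumes "w \<in> Sinf" "0 < a" "a < b"
  shows "cov w a b \<longleftrightarrow> len (rt w a b) = len w + 1"
proof -
  obtain d where d: "b = a + Suc d" using assms(3) by (auto dest: less_imp_Suc_add)
  have inj: "inj w" using assms(1) by (rule Sinf_inj)
  show ?thesis
  proof (cases "w a < w b")
    case True
    have "finite {c. a < c \<and> c < b \<and> w a < w c \<and> w c < w b}" by simp
    then show ?thesis
      using len_rt[OF assms(1,2), of d] True inj assms(3) unfolding d[symmetric] cov_def
      by (auto simp: card_eq_0_iff)
  next
    case False
    then have "w b < w a" using inj assms(3) by (metis injD nat_neq_iff)
    then have "len w > len (rt w a b)"
      using len_rt[of "rt w a b" a d] assms unfolding d[symmetric] by (simp add: Sinf_rt)
    then show ?thesis using False by (simp add: cov_def)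
  qed
qed

text \<open>Without ascents w decreases on 1..n. Counting down from w 1, at most n, bounds each
  value above, and counting up from w n, at least 1, bounds it below; the bounds meet at
  \<open>w0 n\<close>.\<close>

lemma Sn_ascent:
  assumes w: "w \<in> Sn n" and "w \<noteq> w0 n"
  shows "\<exists>i. 0 < i \<and> i < n \<and> w i < w (Suc i)"
proof (rule ccontr)
  assume "\<not> ?thesis"
  moreover have "w i \<noteq> w (Suc i)" for i using Sn_inj[OF w] by (simp add: inj_eq)
  ultimately have desc: "w (Suc i) < w i" if "0 < i" "i < n" for i
    using that by (meson linorder_neqE_nat)
  have le: "w i + i \<le> n + 1" if "0 < i" "i \<le> n" for i
    using that
  proof (induction i)
    case (Suc i)
    show ?case
    proof (cases "i = 0")
      case True
      then show ?thesis using Sn_image[OF w, of 1] Suc by simp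
    next
      case False
      then show ?thesis using Suc desc[of i] by simp
    qed
  qed simp
  have ge: "w (n - d) + (n - d) \<ge> n + 1" if "d < n" for d
    using that
  proof (induction d)
    case 0
    then show ?case using Sinf_pos[OF Sn_Sinf[OF w], of n] by simp
  next
    case (Suc d)
    then have "w (n - d) < w (n - Suc d)"
      using desc[of "n - Suc d"] by (simp add: Suc_diff_Suc)
    then show ?case using Suc by simp
  qed
  have "w i = w0 n i" for i
  proof -
    consider "i = 0" | "0 < i" "i \<le> n" | "n < i" by linarith
    then show ?thesis
    proof cases
      case 1
      then show ?thesis using Sn_Sinf[OF w] by (simp add: w0_def Sinf_def)
    next
      case 2
      then show ?thesis using le[of i] ge[of "n - i"] by (simp add: w0_def)
    next
      case 3
      then show ?thesis using Sn_fix[OF w] by (simp add: w0_def)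
    qed
  qed
  with assms(2) show False by auto
qed

lemma Sn_induct [consumes 1, case_names w0 step]:
  assumes "w \<in> Sn n" and "P (w0 n)"
    and "\<And>w i. w \<in> Sn n \<Longrightarrow> 0 < i \<Longrightarrow> i < n \<Longrightarrow> w (Suc i) < w i \<Longrightarrow> P w \<Longrightarrow> P (rt w i (Suc i))"
  shows "P w"
  using assms(1)
proof (induction "n * n - len w" arbitrary: w rule: less_induct)
  case less
  show ?case
  proof (cases "w = w0 n")
    case False
    then obtain i where i: "0 < i" "i < n" "w i < w (Suc i)"
      using Sn_ascent less.prems by blast
    let ?v = "rt w i (Suc i)"
    have v: "?v \<in> Sn n" using less.prems i by (simp add: Sn_rt)
    have "n * n - len ?v < n * n - len w"
      using len_rt_ascent[OF Sn_Sinf[OF less.prems] i(1,3)] len_le[OF v] by simp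
    then have "P ?v" using v by (rule less.hyps)
    then show ?thesis using assms(3)[OF v i(1,2)] i(3) by simp
  qed (use assms(2) in simp)
qed

subsection \<open>Operators on functions of permutations\<close>

text \<open>
  The operators act on functions $F$ of permutations by precomposition, which avoids formal
  combinations but reverses the order of products: the outermost factor is the first step of a chain.
\<close>

definition bruhat_op :: "gring \<Rightarrow> nat \<Rightarrow> nat \<Rightarrow> ((nat \<Rightarrow> nat) \<Rightarrow> gring) \<Rightarrow> (nat \<Rightarrow> nat) \<Rightarrow> gring" where
  "bruhat_op c a b F w = F w + (if cov w a b then c * F (rt w a b) else 0)"

definition descent_op :: "nat \<Rightarrow> ((nat \<Rightarrow> nat) \<Rightarrow> gring) \<Rightarrow> (nat \<Rightarrow> nat) \<Rightarrow> gring" where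
  "descent_op i F w = (if w (Suc i) < w i then F (rt w i (Suc i)) else 0)"

text \<open>The betweenness condition of \<open>cov\<close> with the set of positions made explicit,
  so that an interval can be cut into blocks and swaps outside a block can be ignored.\<close>

definition gap :: "(nat \<Rightarrow> nat) \<Rightarrow> nat set \<Rightarrow> nat \<Rightarrow> nat \<Rightarrow> bool" where
  "gap w S p q \<longleftrightarrow> (\<forall>c\<in>S. \<not> (p < w c \<and> w c < q))"

lemma cov_gap: "cov w a b \<longleftrightarrow> inj w \<and> a < b \<and> w a < w b \<and> gap w {a<..<b} (w a) (w b)"
  by (auto simp: cov_def gap_def)

lemma gap_insert [simp]: "gap w (insert b S) p q \<longleftrightarrow> \<not> (p < w b \<and> w b < q) \<and> gap w S p q"
  by (auto simp: gap_def)

lemma gap_Un [simp]: "gap w (S \<union> T) p q \<longleftrightarrow> gap w S p q \<and> gap w T p q"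
  by (auto simp: gap_def)

lemma gap_rt: "a \<notin> S \<Longrightarrow> b \<notin> S \<Longrightarrow> gap (rt w a b) S p q \<longleftrightarrow> gap w S p q"
  unfolding gap_def by (rule ball_cong) (auto simp: rt_apply transpose_def)

text \<open>By injectivity no entry of S takes the value w b, so the value interval can be cut
  there.\<close>

lemma gap_split:
  assumes "inj w" "b \<notin> S" "p < w b" "w b < q"
  shows "gap w S p q \<longleftrightarrow> gap w S p (w b) \<and> gap w S (w b) q"
proof -
  have "w c \<noteq> w b" if "c \<in> S" for c using assms(1,2) that by (auto simp: inj_eq)
  then show ?thesis using assms(3,4) unfolding gap_def by (meson less_trans nat_neq_iff)
qed

lemma rt_conj:
  "rt (rt w i j) a b = rt (rt w (transpose i j a) (transpose i j b)) i j"
proof -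
  have "transpose i j \<circ> transpose a b
      = transpose (transpose i j a) (transpose i j b) \<circ> transpose i j"
    by (auto simp: fun_eq_iff transpose_def)
  then show ?thesis by (simp add: rt_def comp_assoc)
qed

text \<open>If s_i moves an endpoint, one of the two intervals contains one position more than the
  other. The requirement on the extra entry is then exchanged for the descent condition of the other
  side.\<close>

lemma descent_op_bruhat_op:
  assumes "a < b" "(a, b) \<noteq> (i, Suc i)"
  shows "descent_op i (bruhat_op c a b F)
      = bruhat_op c (transpose i (Suc i) a) (transpose i (Suc i) b) (descent_op i F)"
proof
  fix w
  let ?t = "transpose i (Suc i)"
  let ?v = "rt w i (Suc i)" and ?u = "rt w (?t a) (?t b)"
  have eq: "rt ?v a b = rt ?u i (Suc i)" by (rule rt_conj)
  have "w (Suc i) < w i \<and> cov ?v a b \<longleftrightarrow> cov w (?t a) (?t b) \<and> ?u (Suc i) < ?u i"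
  proof -
    consider (none) "a \<noteq> i" "a \<noteq> Suc i" "b \<noteq> i" "b \<noteq> Suc i"
      | (ai) "a = i" "Suc i < b" | (aS) "a = Suc i" "Suc i < b"
      | (bi) "b = i" "a < i" | (bS) "b = Suc i" "a < i"
      using assms by fastforce
    then show ?thesis
    proof cases
      case none
      \<comment> \<open>Here s_i only permutes the positions inside the interval or those outside
        it.\<close>
      then have "?t c \<in> {a<..<b}" if "c \<in> {a<..<b}" for c
        using that by (auto simp: transpose_def)
      then have "gap ?v {a<..<b} p q \<longleftrightarrow> gap w {a<..<b} p q" for p q
        unfolding gap_def rt_apply by (metis transpose_involutory)
      with none show ?thesis by (auto simp: cov_gap)
    next
      case ai
      then have "{i<..<b} = insert (Suc i) {Suc i<..<b}" by auto
      with ai show ?thesis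
        by (auto simp: cov_gap gap_rt inj_eq not_less order.order_iff_strict)
    next
      case aS
      then have "{i<..<b} = insert (Suc i) {Suc i<..<b}" by auto
      with aS show ?thesis
        by (auto simp: cov_gap gap_rt inj_eq not_less order.order_iff_strict)
    next
      case bi
      then have "{a<..<Suc i} = insert i {a<..<i}" by auto
      with bi show ?thesis
        by (auto simp: cov_gap gap_rt inj_eq not_less order.order_iff_strict)
    next
      case bS
      then have "{a<..<Suc i} = insert i {a<..<i}" by auto
      with bS show ?thesis
        by (auto simp: cov_gap gap_rt inj_eq not_less order.order_iff_strict)
    qed
  qed
  then show "descent_op i (bruhat_op c a b F) w = bruhat_op c (?t a) (?t b) (descent_op i F) w"
    unfolding descent_op_def bruhat_op_def eq by auto
qed

lemma bruhat_op_commute: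
  assumes "a \<noteq> i" "a \<noteq> Suc i" "b \<noteq> i" "b \<noteq> Suc i"
  shows "bruhat_op d i (Suc i) (bruhat_op c a b F) = bruhat_op c a b (bruhat_op d i (Suc i) F)"
proof
  fix w
  have "transpose i (Suc i) c \<in> {a<..<b}" if "c \<in> {a<..<b}" for c
    using that assms by (auto simp: transpose_def)
  then have "gap (rt w i (Suc i)) {a<..<b} p q \<longleftrightarrow> gap w {a<..<b} p q" for p q
    unfolding gap_def rt_apply by (metis transpose_involutory)
  then have "cov (rt w i (Suc i)) a b \<longleftrightarrow> cov w a b"
    using assms by (simp add: cov_gap)
  moreover have "cov (rt w a b) i (Suc i) \<longleftrightarrow> cov w i (Suc i)"
    using assms by (simp add: cov_def)
  moreover have "rt (rt w a b) i (Suc i) = rt (rt w i (Suc i)) a b"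
    using assms by (intro rt_commute) auto
  ultimately show "bruhat_op d i (Suc i) (bruhat_op c a b F) w = bruhat_op c a b
      (bruhat_op d i (Suc i) F) w"
    by (simp add: bruhat_op_def algebra_simps)
qed

lemma bruhat_op_Yang_Baxter:
  assumes "a < b" "b < c"
  shows "bruhat_op d a b (bruhat_op d a c (bruhat_op d b c F)) = bruhat_op d b c (bruhat_op d a c
      (bruhat_op d a b F))"
proof
  fix w
  show "bruhat_op d a b (bruhat_op d a c (bruhat_op d b c F)) w = bruhat_op d b c
      (bruhat_op d a c (bruhat_op d a b F)) w"
  proof (cases "inj w")
    case False
    then show ?thesis by (simp add: bruhat_op_def cov_def)
  next
    case inj: True
    \<comment> \<open>Different paths in the symmetric group on the three positions reach the same
      permutation; these coincidences let the terms of both sides be compared.\<close>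
    have perms: "rt (rt w a c) b c = rt (rt w a b) a c" "rt (rt w b c) a b = rt (rt w a b) a c"
      "rt (rt w a c) a b = rt (rt w a b) b c" "rt (rt w b c) a c = rt (rt w a b) b c"
      "rt (rt (rt w a b) a c) b c = rt w a c" "rt (rt (rt w a b) b c) a b = rt w a c"
      using assms by (auto simp: rt_def fun_eq_iff transpose_def)
    have ne: "\<not> b < a" "\<not> c < b" "\<not> c < a" "a \<noteq> b" "b \<noteq> a" "a \<noteq> c" "c \<noteq> a" "b \<noteq> c" "c \<noteq> b" "a < c"
      using assms by auto
    have I: "{a<..<c} = insert b ({a<..<b} \<union> {b<..<c})" using assms by auto
    have mem: "a \<notin> {a<..<b}" "b \<notin> {a<..<b}" "c \<notin> {a<..<b}" "a \<notin> {b<..<c}" "b \<notin> {b<..<c}"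
        "c \<notin> {b<..<c}"
      using assms by auto
    note eval = bruhat_op_def cov_gap I ne assms perms gap_rt mem inj
    have neq: "w a \<noteq> w b" "w b \<noteq> w c" "w a \<noteq> w c"
      using inj ne by (simp_all add: inj_eq)
    then consider "w a < w b \<and> w b < w c" | "w a < w c \<and> w c < w b" | "w b < w a \<and> w a < w c"
      | "w b < w c \<and> w c < w a" | "w c < w a \<and> w a < w b" | "w c < w b \<and> w b < w a"
      by linarith
    then show ?thesis
    proof cases
      case 1
      then have o: "w a < w b" "w b < w c" "w a < w c"
        and no: "\<not> w b < w a" "\<not> w c < w b" "\<not> w c < w a" by auto
      show ?thesis
        by (simp add: eval o no gap_split[OF inj mem(2) o(1,2)] gap_split[OF inj mem(5) o(1,2)]
            split del: if_split cong: if_cong;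
            simp add: algebra_simps)
    next
      case 2
      then have o: "w a < w c" "w c < w b" "w a < w b"
        and no: "\<not> w c < w a" "\<not> w b < w c" "\<not> w b < w a" by auto
      show ?thesis
        by (simp add: eval o no gap_split[OF inj mem(3) o(1,2)] gap_split[OF inj mem(6) o(1,2)]
            split del: if_split cong: if_cong;
            simp add: algebra_simps)
    next
      case 3
      then have o: "w b < w a" "w a < w c" "w b < w c"
        and no: "\<not> w a < w b" "\<not> w c < w a" "\<not> w c < w b" by auto
      show ?thesis
        by (simp add: eval o no gap_split[OF inj mem(1) o(1,2)] gap_split[OF inj mem(4) o(1,2)]
            split del: if_split cong: if_cong;
            simp add: algebra_simps)
    next
      case 4
      then have o: "w b < w c" "w c < w a" "w b < w a"
        and no: "\<not> w c < w b" "\<not> w a < w c" "\<not> w a < w b" by auto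
      show ?thesis
        by (simp add: eval o no split del: if_split cong: if_cong;
            simp add: algebra_simps)
    next
      case 5
      then have o: "w c < w a" "w a < w b" "w c < w b"
        and no: "\<not> w a < w c" "\<not> w b < w a" "\<not> w b < w c" by auto
      show ?thesis
        by (simp add: eval o no split del: if_split cong: if_cong;
            simp add: algebra_simps)
    next
      case 6
      then have o: "w c < w b" "w b < w a" "w c < w a"
        and no: "\<not> w b < w c" "\<not> w a < w b" "\<not> w a < w c" by auto
      show ?thesis
        by (simp add: eval o no split del: if_split cong: if_cong;
            simp add: algebra_simps)
    qed
  qed
qed

text \<open>T_ab squares to zero: after the swap the entries at a and b decrease.\<close>

lemma bruhat_op_inverse: "bruhat_op (- d) a b (bruhat_op d a b F) = F"
proof
  fix w show "bruhat_op (- d) a b (bruhat_op d a b F) w = F w"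
    by (simp add: bruhat_op_def) (simp add: cov_def)
qed

lemma bruhat_op_inverse': "bruhat_op d a b (bruhat_op (- d) a b F) = F"
  using bruhat_op_inverse[of "- d"] by simp

section \<open>The operator of the formula and its commutation rules\<close>

definition weight_op :: "nat \<Rightarrow> ((nat \<Rightarrow> nat) \<Rightarrow> gring) \<Rightarrow> (nat \<Rightarrow> nat) \<Rightarrow> gring" where
  "weight_op k F w = finv (1 + beta * yv (w k)) * F w"

definition bruhat_prod :: "gring \<Rightarrow> (nat \<times> nat) list \<Rightarrow> ((nat \<Rightarrow> nat) \<Rightarrow> gring) \<Rightarrow> (nat \<Rightarrow> nat) \<Rightarrow> gring" where
  "bruhat_prod c ps F = foldr (\<lambda>(a, b). bruhat_op c a b) ps F"

lemma bruhat_prod_simps [simp]: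
  "bruhat_prod c [] F = F"
  "bruhat_prod c ((a, b) # ps) F = bruhat_op c a b (bruhat_prod c ps F)"
  "bruhat_prod c (ps @ qs) F = bruhat_prod c ps (bruhat_prod c qs F)"
  by (simp_all add: bruhat_prod_def)

text \<open>Reversed because chains use decreasing positions and the head of the list is the first
  step.\<close>

abbreviation lowers :: "nat \<Rightarrow> nat list \<Rightarrow> (nat \<times> nat) list" where
  "lowers k as \<equiv> map (\<lambda>a. (a, k)) (rev as)"

abbreviation uppers :: "nat \<Rightarrow> nat list \<Rightarrow> (nat \<times> nat) list" where
  "uppers k bs \<equiv> map (\<lambda>b. (k, b)) (rev bs)"

definition monk_op :: "nat \<Rightarrow> nat \<Rightarrow> ((nat \<Rightarrow> nat) \<Rightarrow> gring) \<Rightarrow> (nat \<Rightarrow> nat) \<Rightarrow> gring" where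
  "monk_op N k F = bruhat_prod (- beta) (lowers k [1..<k]) (weight_op k
      (bruhat_prod beta (uppers k [Suc k..<Suc N]) F))"

lemma descent_op_bruhat_prod:
  assumes "\<And>a b. (a, b) \<in> set ps \<Longrightarrow> a < b \<and> (a, b) \<noteq> (i, Suc i)"
  shows "descent_op i (bruhat_prod c ps F)
    = bruhat_prod c (map (map_prod (transpose i (Suc i)) (transpose i (Suc i))) ps)
        (descent_op i F)"
  using assms
proof (induction ps)
  case (Cons p ps)
  obtain a b where [simp]: "p = (a, b)" by force
  have "a < b" "(a, b) \<noteq> (i, Suc i)" using Cons.prems[of a b] by auto
  moreover have "descent_op i (bruhat_prod c ps F)
    = bruhat_prod c (map (map_prod (transpose i (Suc i)) (transpose i (Suc i))) ps)
        (descent_op i F)"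
    using Cons.prems by (intro Cons.IH) auto
  ultimately show ?case by (simp add: descent_op_bruhat_op)
qed simp

lemma descent_op_bruhat_prod_fixed:
  assumes "\<And>a b. (a, b) \<in> set ps \<Longrightarrow> a < b \<and> a \<notin> {i, Suc i} \<and> b \<notin> {i, Suc i}"
  shows "descent_op i (bruhat_prod c ps F) = bruhat_prod c ps (descent_op i F)"
proof -
  have "map (map_prod (transpose i (Suc i)) (transpose i (Suc i))) ps = ps"
    using assms by (intro map_idI) (force simp: transpose_def)
  moreover have "a < b \<and> (a, b) \<noteq> (i, Suc i)" if "(a, b) \<in> set ps" for a b
    using assms[OF that] by auto
  ultimately show ?thesis using descent_op_bruhat_prod[of ps i] by metis
qed

lemma bruhat_op_bruhat_prod_commute:
  assumes "\<And>a b. (a, b) \<in> set ps \<Longrightarrow> a \<notin> {i, Suc i} \<and> b \<notin> {i, Suc i}"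
  shows "bruhat_prod c ps (bruhat_op d i (Suc i) F) = bruhat_op d i (Suc i) (bruhat_prod c ps F)"
  using assms
proof (induction ps)
  case (Cons p ps)
  obtain a b where [simp]: "p = (a, b)" by force
  have "a \<noteq> i" "a \<noteq> Suc i" "b \<noteq> i" "b \<noteq> Suc i" using Cons.prems[of a b] by auto
  moreover have "bruhat_prod c ps (bruhat_op d i (Suc i) F) = bruhat_op d i (Suc i)
      (bruhat_prod c ps F)"
    using Cons.prems by (intro Cons.IH) auto
  ultimately show ?case by (simp add: bruhat_op_commute)
qed simp

text \<open>All the other indices are fixed by s_i, so N_i just exchanges the columns i and i +
  1.\<close>

lemma descent_op_lowers:
  assumes "\<And>a. a \<in> set as \<Longrightarrow> a < i"
  shows "descent_op i (bruhat_prod c (lowers i as) F) = bruhat_prod c (lowers (Suc i) as)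
      (descent_op i F)"
    and "descent_op i (bruhat_prod c (lowers (Suc i) as) F) = bruhat_prod c (lowers i as)
        (descent_op i F)"
proof -
  let ?t = "transpose i (Suc i)"
  have fixed: "?t a = a" if "a \<in> set as" for a using assms[OF that] by (simp add: transpose_def)
  have maps: "map (map_prod ?t ?t) (lowers i as) = lowers (Suc i) as"
      "map (map_prod ?t ?t) (lowers (Suc i) as) = lowers i as"
    by (auto simp: fixed)
  show "descent_op i (bruhat_prod c (lowers i as) F) = bruhat_prod c (lowers (Suc i) as)
      (descent_op i F)"
    unfolding maps(1)[symmetric] using assms by (intro descent_op_bruhat_prod) auto
  show "descent_op i (bruhat_prod c (lowers (Suc i) as) F) = bruhat_prod c (lowers i as)
      (descent_op i F)"
    unfolding maps(2)[symmetric] using assms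
        by (intro descent_op_bruhat_prod) (force simp: less_Suc_eq)
qed

lemma descent_op_uppers:
  assumes "\<And>b. b \<in> set bs \<Longrightarrow> Suc i < b"
  shows "descent_op i (bruhat_prod c (uppers i bs) F) = bruhat_prod c (uppers (Suc i) bs)
      (descent_op i F)"
    and "descent_op i (bruhat_prod c (uppers (Suc i) bs) F) = bruhat_prod c (uppers i bs)
        (descent_op i F)"
proof -
  let ?t = "transpose i (Suc i)"
  have fixed: "?t b = b" if "b \<in> set bs" for b using assms[OF that] by (simp add: transpose_def)
  have maps: "map (map_prod ?t ?t) (uppers i bs) = uppers (Suc i) bs"
      "map (map_prod ?t ?t) (uppers (Suc i) bs) = uppers i bs"
    by (auto simp: fixed)
  show "descent_op i (bruhat_prod c (uppers i bs) F) = bruhat_prod c (uppers (Suc i) bs)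
      (descent_op i F)"
    unfolding maps(1)[symmetric] using assms by (intro descent_op_bruhat_prod) force
  show "descent_op i (bruhat_prod c (uppers (Suc i) bs) F) = bruhat_prod c (uppers i bs)
      (descent_op i F)"
    unfolding maps(2)[symmetric] using assms by (intro descent_op_bruhat_prod) force
qed

lemma descent_op_weight_op: "descent_op i (weight_op k F) = weight_op (transpose i (Suc i) k)
    (descent_op i F)"
  by (auto simp: descent_op_def weight_op_def rt_apply fun_eq_iff)

lemma bruhat_op_weight_op:
  assumes "k \<noteq> i" "k \<noteq> Suc i"
  shows "weight_op k (bruhat_op d i (Suc i) F) = bruhat_op d i (Suc i) (weight_op k F)"
  using assms by (auto simp: bruhat_op_def weight_op_def fun_eq_iff algebra_simps)

lemma bruhat_prod_linear:
  assumes "\<And>f g. p (f + g) = p f + p g" "\<And>f. p (c * f) = c * p f"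
  shows "bruhat_prod c ps (\<lambda>v. p (F v)) = (\<lambda>v. p (bruhat_prod c ps F v))"
proof -
  have "p 0 = 0" using assms(1)[of 0 0] by simp
  then show ?thesis by (induction ps) (auto simp: bruhat_op_def fun_eq_iff assms)
qed

text \<open>The operator moves permutations and p acts on values. Its coefficients, beta and the
  inverses of 1 + beta y_j, are fixed by every swap, hence pass through p.\<close>

lemma monk_op_linear:
  assumes add: "\<And>f g. p (f + g) = p f + p g" and scale: "\<And>i c f. (\<And>i. sx i c = c) \<Longrightarrow> p (c * f) = c
      * p f"
  shows "monk_op N k (\<lambda>v. p (F v)) = (\<lambda>v. p (monk_op N k F v))"
proof -
  have beta: "p (beta * f) = beta * p f" "p (- beta * f) = - beta * p f" for f
    by (rule scale, simp)+
  have Q: "weight_op k (\<lambda>v. p (H v)) = (\<lambda>v. p (weight_op k H v))" for H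
    by (simp add: weight_op_def fun_eq_iff scale)
  show ?thesis
    unfolding monk_op_def by (simp only: bruhat_prod_linear[OF add beta(1)] bruhat_prod_linear[OF add beta(2)] Q)
qed

lemma monk_op_ddiff: "monk_op N k (\<lambda>v. ddiff i (F v)) = (\<lambda>v. ddiff i (monk_op N k F v))"
  by (rule monk_op_linear) (simp_all add: ddiff_add ddiff_scale)

lemma descent_op_descent: "w (Suc i) < w i \<Longrightarrow> descent_op i F w = F (rt w i (Suc i))"
  by (simp add: descent_op_def)

lemma bruhat_op_descent: "w b < w a \<Longrightarrow> bruhat_op d a b F w = F w"
  by (simp add: bruhat_op_def cov_def)

text \<open>What the inductive step requires of the polynomials at one index i. It is demanded for
  all maps w, since the operator identities are equations between functions on all maps.\<close>

locale ddiff_family =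
  fixes G :: "(nat \<Rightarrow> nat) \<Rightarrow> gring" and i :: nat
  assumes descent: "w (Suc i) < w i \<Longrightarrow> G (rt w i (Suc i)) = ddiff i (G w)"
    and not_inj: "\<not> inj w \<Longrightarrow> G w = 0"
begin

text \<open>At an ascent, G w is itself in the image of pi_i, where pi_i acts as - beta.\<close>

lemma ascent: "w i < w (Suc i) \<Longrightarrow> ddiff i (G w) = - beta * G w"
  using descent[of "rt w i (Suc i)"] ddiff_ddiff[of i "G (rt w i (Suc i))"] by simp

lemma cov_ascent: "inj w \<Longrightarrow> cov w i (Suc i) \<longleftrightarrow> w i < w (Suc i)"
  by (auto simp: cov_def)

lemma descent_op_bruhat_op_self: "descent_op i (bruhat_op beta i (Suc i) G) = (\<lambda>w. ddiff i (G w)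
    + beta * G w)"
proof
  fix w
  show "descent_op i (bruhat_op beta i (Suc i) G) w = ddiff i (G w) + beta * G w"
  proof (cases "inj w")
    case True
    then have "w i < w (Suc i) \<or> w (Suc i) < w i" by (metis inj_eq n_not_Suc_n nat_neq_iff)
    then show ?thesis
      using True by (auto simp: descent_op_def bruhat_op_def cov_ascent descent ascent)
  next
    case False
    then show ?thesis by (simp add: descent_op_def bruhat_op_def not_inj)
  qed
qed

text \<open>At a descent there is no cover and both sides are G (w s_i). At an ascent the two terms
  on the right are - beta G w and beta G w.\<close>

lemma descent_op_self: "descent_op i G = bruhat_op beta i (Suc i) (\<lambda>w. ddiff i (G w))"
proof
  fix w
  show "descent_op i G w = bruhat_op beta i (Suc i) (\<lambda>w. ddiff i (G w)) w"
  proof (cases "inj w")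
    case True
    then have "w i < w (Suc i) \<or> w (Suc i) < w i" by (metis inj_eq n_not_Suc_n nat_neq_iff)
    then show ?thesis
      using True by (auto simp: descent_op_def bruhat_op_def cov_ascent descent ascent simp flip: descent)
  next
    case False
    then show ?thesis by (simp add: descent_op_def bruhat_op_def not_inj)
  qed
qed

text \<open>The innermost factor of M_i is the one at (i, i + 1); together with N_i it yields pi_i +
  beta. The other factors move to column i + 1, and the outermost factor of M_(i+1), at (i, i + 1),
  is inert at w.\<close>

lemma monk_op_rt_left:
  assumes "0 < i" "Suc i \<le> N" "w (Suc i) < w i"
  shows "monk_op N i G (rt w i (Suc i)) = ddiff i (monk_op N (Suc i) G w) + beta
      * monk_op N (Suc i) G w"
proof -
  let ?L = "\<lambda>k. lowers k [1..<i]" and ?U = "\<lambda>k. uppers k [Suc (Suc i)..<Suc N]"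
  let ?p = "\<lambda>f. ddiff i f + beta * f"
  have cL: "a \<in> set [1..<i] \<Longrightarrow> a < i" and cU: "b \<in> set [Suc (Suc i)..<Suc N] \<Longrightarrow> Suc i < b" for a b
    by auto
  have U: "uppers i [Suc i..<Suc N] = ?U i @ [(i, Suc i)]"
    using assms(2) by (simp add: upt_conv_Cons del: upt_Suc)
  have L: "lowers (Suc i) [1..<Suc i] = (i, Suc i) # ?L (Suc i)"
    using assms(1) by simp
  have lin: "monk_op N (Suc i) (\<lambda>v. ?p (F v)) w = ?p (monk_op N (Suc i) F w)" for F
    by (rule fun_cong[OF monk_op_linear[where p = ?p]])
      (simp_all add: ddiff_add ddiff_scale distrib_left mult.left_commute)
  have "descent_op i (monk_op N i G) w
      = bruhat_prod (- beta) (?L (Suc i)) (weight_op (Suc i) (bruhat_prod beta (?U (Suc i))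
          (descent_op i (bruhat_op beta i (Suc i) G)))) w"
    unfolding monk_op_def U bruhat_prod_simps
    by (simp only: descent_op_lowers[OF cL] descent_op_uppers[OF cU] descent_op_weight_op
          transpose_apply_first transpose_apply_second)
  also have "\<dots> = monk_op N (Suc i) (\<lambda>v. ?p (G v)) w"
    unfolding monk_op_def L bruhat_prod_simps descent_op_bruhat_op_self using assms(3)
        by (simp only: bruhat_op_descent)
  also have "\<dots> = ?p (monk_op N (Suc i) G w)" by (rule lin[of G])
  finally show ?thesis
    unfolding descent_op_descent[of w i, OF assms(3)] .
qed

text \<open>Let H be M_(i+1) applied to G without its outermost factor, which is inert at w but
  subtracts beta H w at w s_i. Passing N_i through H turns column i + 1 into column i, and the extra
  factor of \<open>descent_op_self\<close> is exactly the one still missing from M_i.\<close>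

lemma monk_op_rt_right:
  assumes "0 < i" "Suc i \<le> N" "inj w" "w (Suc i) < w i"
  shows "monk_op N (Suc i) G (rt w i (Suc i)) = ddiff i (monk_op N i G w) - beta
      * monk_op N (Suc i) G w"
proof -
  let ?L = "\<lambda>k. lowers k [1..<i]" and ?U = "\<lambda>k. uppers k [Suc (Suc i)..<Suc N]"
  define H where "H = bruhat_prod (- beta) (?L (Suc i)) (weight_op (Suc i)
      (bruhat_prod beta (?U (Suc i)) G))"
  have cL: "a \<in> set [1..<i] \<Longrightarrow> a < i" and cU: "b \<in> set [Suc (Suc i)..<Suc N] \<Longrightarrow> Suc i < b" for a b
    by auto
  have U: "uppers i [Suc i..<Suc N] = ?U i @ [(i, Suc i)]"
    using assms(2) by (simp add: upt_conv_Cons del: upt_Suc)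
  have L: "lowers (Suc i) [1..<Suc i] = (i, Suc i) # ?L (Suc i)"
    using assms(1) by simp
  have monk_op: "monk_op N (Suc i) G = bruhat_op (- beta) i (Suc i) H"
    unfolding monk_op_def L H_def by simp
  have "descent_op i H = monk_op N i (\<lambda>v. ddiff i (G v))"
    unfolding monk_op_def U H_def bruhat_prod_simps descent_op_self[symmetric]
    by (simp only: descent_op_lowers[OF cL] descent_op_uppers[OF cU] descent_op_weight_op
          transpose_apply_first transpose_apply_second)
  then have "H (rt w i (Suc i)) = ddiff i (monk_op N i G w)"
    by (simp only: monk_op_ddiff flip: descent_op_descent[of w i, OF assms(4)])
  moreover have "cov (rt w i (Suc i)) i (Suc i)"
    using assms by (simp add: cov_def)
  moreover have "monk_op N (Suc i) G w = H w"
    unfolding monk_op using assms(4) by (simp add: bruhat_op_descent)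
  ultimately show ?thesis
    by (simp add: monk_op bruhat_op_def)
qed

text \<open>N_i interchanges the upper factors at i and i + 1. The extra factor at (i, i + 1)
  restores their order by Yang-Baxter while moving to the outside.\<close>

lemma monk_op_rt_above:
  assumes "k < i" "Suc i \<le> N" "w (Suc i) < w i"
  shows "monk_op N k G (rt w i (Suc i)) = ddiff i (monk_op N k G w)"
proof -
  let ?L = "lowers k [1..<k]" and ?U1 = "uppers k [Suc k..<i]" and ?U2 =
      "uppers k [Suc (Suc i)..<Suc N]"
  have "[Suc k..<Suc N] = [Suc k..<i] @ [i, Suc i] @ [Suc (Suc i)..<Suc N]"
    using assms upt_add_eq_append[of "Suc k" i "Suc N - i"]
        by (simp add: upt_conv_Cons del: upt_Suc)
  then have U: "uppers k [Suc k..<Suc N] = ?U2 @ [(k, Suc i), (k, i)] @ ?U1" by simp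
  define F where "F = (\<lambda>v. ddiff i (G v))"
  have fixed: "a < b \<and> a \<notin> {i, Suc i} \<and> b \<notin> {i, Suc i}" if "(a, b) \<in> set ?L \<union> set ?U1 \<union> set ?U2"
      for a b
    using that assms by auto
  have Q: "transpose i (Suc i) k = k" using assms(1) by (simp add: transpose_def)
  let ?V = "bruhat_op beta k (Suc i) (bruhat_op beta k i (bruhat_prod beta ?U1 G))"
  have "descent_op i (monk_op N k G) = bruhat_prod (- beta) ?L (descent_op i (weight_op k
      (bruhat_prod beta ?U2 ?V)))"
    unfolding monk_op_def U bruhat_prod_simps
        by (rule descent_op_bruhat_prod_fixed, rule fixed, blast)
  also have "descent_op i (weight_op k (bruhat_prod beta ?U2 ?V)) = weight_op k (descent_op i
      (bruhat_prod beta ?U2 ?V))"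
    unfolding descent_op_weight_op Q ..
  also have "descent_op i (bruhat_prod beta ?U2 ?V) = bruhat_prod beta ?U2 (descent_op i ?V)"
    by (rule descent_op_bruhat_prod_fixed, rule fixed, blast)
  also have "descent_op i (bruhat_op beta k (Suc i) (bruhat_op beta k i (bruhat_prod beta ?U1 G)))
      = bruhat_op beta k i (bruhat_op beta k (Suc i) (descent_op i (bruhat_prod beta ?U1 G)))"
    using assms(1) by (simp add: descent_op_bruhat_op transpose_def)
  also have "descent_op i (bruhat_prod beta ?U1 G) = bruhat_prod beta ?U1
      (bruhat_op beta i (Suc i) F)"
    unfolding F_def descent_op_self[symmetric]
        by (rule descent_op_bruhat_prod_fixed, rule fixed, blast)
  also have "\<dots> = bruhat_op beta i (Suc i) (bruhat_prod beta ?U1 F)"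
    by (rule bruhat_op_bruhat_prod_commute, rule conjunct2[OF fixed], blast)
  also have "bruhat_op beta k i (bruhat_op beta k (Suc i) (bruhat_op beta i (Suc i)
      (bruhat_prod beta ?U1 F)))
      = bruhat_op beta i (Suc i) (bruhat_op beta k (Suc i) (bruhat_op beta k i
          (bruhat_prod beta ?U1 F)))"
    by (rule bruhat_op_Yang_Baxter[OF assms(1) lessI])
  also have "bruhat_prod beta ?U2 \<dots> = bruhat_op beta i (Suc i) (bruhat_prod beta ?U2
      (bruhat_op beta k (Suc i) (bruhat_op beta k i (bruhat_prod beta ?U1 F))))"
    by (rule bruhat_op_bruhat_prod_commute, rule conjunct2[OF fixed], blast)
  also have "weight_op k \<dots> = bruhat_op beta i (Suc i) (weight_op k (bruhat_prod beta ?U2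
      (bruhat_op beta k (Suc i) (bruhat_op beta k i (bruhat_prod beta ?U1 F)))))"
    using assms(1) by (intro bruhat_op_weight_op) auto
  also have "bruhat_prod (- beta) ?L \<dots> = bruhat_op beta i (Suc i) (bruhat_prod (- beta) ?L
      (weight_op k (bruhat_prod beta ?U2 (bruhat_op beta k (Suc i) (bruhat_op beta k i
          (bruhat_prod beta ?U1 F))))))"
    by (rule bruhat_op_bruhat_prod_commute, rule conjunct2[OF fixed], blast)
  also have "\<dots> = bruhat_op beta i (Suc i) (monk_op N k F)"
    unfolding monk_op_def U by simp
  finally have "descent_op i (monk_op N k G) w = monk_op N k F w"
    using assms(3) by (simp add: bruhat_op_descent)
  then show ?thesis
    using assms(3) by (simp add: descent_op_descent F_def monk_op_ddiff)
qed

lemma monk_op_rt_below: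
  assumes "0 < i" "Suc i < k" "w (Suc i) < w i"
  shows "monk_op N k G (rt w i (Suc i)) = ddiff i (monk_op N k G w)"
proof -
  let ?L1 = "lowers k [1..<i]" and ?L2 = "lowers k [Suc (Suc i)..<k]" and ?U =
      "uppers k [Suc k..<Suc N]"
  have "[1..<k] = [1..<i] @ [i, Suc i] @ [Suc (Suc i)..<k]"
    using assms upt_add_eq_append[of 1 i "k - i"] by (simp add: upt_conv_Cons del: upt_Suc)
  then have L: "lowers k [1..<k] = ?L2 @ [(Suc i, k), (i, k)] @ ?L1" by simp
  define F where "F = (\<lambda>v. ddiff i (G v))"
  have fixed: "a < b \<and> a \<notin> {i, Suc i} \<and> b \<notin> {i, Suc i}" if "(a, b) \<in> set ?L1 \<union> set ?L2 \<union> set ?U"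
      for a b
    using that assms by auto
  let ?H = "\<lambda>F. bruhat_prod (- beta) ?L1 (weight_op k (bruhat_prod beta ?U F))"
  have H: "?H (bruhat_op beta i (Suc i) F) = bruhat_op beta i (Suc i) (?H F)"
  proof -
    have "bruhat_prod beta ?U (bruhat_op beta i (Suc i) F) = bruhat_op beta i (Suc i)
        (bruhat_prod beta ?U F)"
      by (rule bruhat_op_bruhat_prod_commute, rule conjunct2[OF fixed], blast)
    moreover have "weight_op k (bruhat_op beta i (Suc i) (bruhat_prod beta ?U F))
        = bruhat_op beta i (Suc i) (weight_op k (bruhat_prod beta ?U F))"
      using assms(2) by (intro bruhat_op_weight_op) auto
    moreover have "bruhat_prod (- beta) ?L1 (bruhat_op beta i (Suc i) (weight_op k
        (bruhat_prod beta ?U F)))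
        = bruhat_op beta i (Suc i) (?H F)"
      by (rule bruhat_op_bruhat_prod_commute, rule conjunct2[OF fixed], blast)
    ultimately show ?thesis by simp
  qed
  \<comment> \<open>The lower factors carry - beta but the incoming factor carries beta, so
    Yang-Baxter does not apply directly. It is used with - beta throughout and multiplied on both
    sides by the inverse of its (i, i + 1) factor.\<close>
  have YB: "bruhat_op (- beta) i k (bruhat_op (- beta) (Suc i) k (bruhat_op beta i (Suc i) Z))
      = bruhat_op beta i (Suc i) (bruhat_op (- beta) (Suc i) k (bruhat_op (- beta) i k Z))" for Z
  proof -
    have "bruhat_op beta i (Suc i) (bruhat_op (- beta) (Suc i) k (bruhat_op (- beta) i k
        (bruhat_op (- beta) i (Suc i) (bruhat_op beta i (Suc i) Z))))
        = bruhat_op beta i (Suc i) (bruhat_op (- beta) i (Suc i) (bruhat_op (- beta) i k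
            (bruhat_op (- beta) (Suc i) k (bruhat_op beta i (Suc i) Z))))"
      by (simp only: bruhat_op_Yang_Baxter[OF lessI assms(2)])
    then show ?thesis by (simp add: bruhat_op_inverse bruhat_op_inverse')
  qed
  have "descent_op i (monk_op N k G) = bruhat_prod (- beta) ?L2 (descent_op i
      (bruhat_op (- beta) (Suc i) k (bruhat_op (- beta) i k (?H G))))"
    unfolding monk_op_def L bruhat_prod_simps
        by (rule descent_op_bruhat_prod_fixed, rule fixed, blast)
  also have "descent_op i (bruhat_op (- beta) (Suc i) k (bruhat_op (- beta) i k (?H G)))
      = bruhat_op (- beta) i k (bruhat_op (- beta) (Suc i) k (descent_op i (?H G)))"
    using assms(2) by (simp add: descent_op_bruhat_op transpose_def)
  also have "descent_op i (?H G) = ?H (bruhat_op beta i (Suc i) F)"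
  proof -
    have "descent_op i (bruhat_prod beta ?U G) = bruhat_prod beta ?U (bruhat_op beta i (Suc i) F)"
      unfolding F_def descent_op_self[symmetric]
          by (rule descent_op_bruhat_prod_fixed, rule fixed, blast)
    moreover have "descent_op i (?H G) = bruhat_prod (- beta) ?L1 (descent_op i (weight_op k
        (bruhat_prod beta ?U G)))"
      by (rule descent_op_bruhat_prod_fixed, rule fixed, blast)
    ultimately show ?thesis using assms(2) by (simp add: descent_op_weight_op transpose_def)
  qed
  also have "\<dots> = bruhat_op beta i (Suc i) (?H F)" by (rule H)
  also note YB
  also have "bruhat_prod (- beta) ?L2 (bruhat_op beta i (Suc i) (bruhat_op (- beta) (Suc i) k
      (bruhat_op (- beta) i k (?H F))))
      = bruhat_op beta i (Suc i) (bruhat_prod (- beta) ?L2 (bruhat_op (- beta) (Suc i) k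
          (bruhat_op (- beta) i k (?H F))))"
    by (rule bruhat_op_bruhat_prod_commute, rule conjunct2[OF fixed], blast)
  also have "\<dots> = bruhat_op beta i (Suc i) (monk_op N k F)"
    unfolding monk_op_def L by simp
  finally have "descent_op i (monk_op N k G) w = monk_op N k F w"
    using assms(3) by (simp add: bruhat_op_descent)
  then show ?thesis
    using assms(3) by (simp add: descent_op_descent F_def monk_op_ddiff)
qed

lemma monk_op_step:
  assumes "0 < i" "Suc i < N" "inj w" "w (Suc i) < w i"
    and hyp: "\<And>k. 0 < k \<Longrightarrow> k < N \<Longrightarrow> monk_op N k G w = (1 + beta * xv k) * G w"
    and "0 < k" "k < N"
  shows "monk_op N k G (rt w i (Suc i)) = (1 + beta * xv k) * G (rt w i (Suc i))"
proof -
  have N: "Suc i \<le> N" using assms(2) by simp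
  consider "k = i" | "k = Suc i" | "k < i" | "Suc i < k" by linarith
  then show ?thesis
  proof cases
    case 1
    then show ?thesis
      using monk_op_rt_left[OF assms(1) N assms(4)] hyp[of "Suc i"] assms
      by (simp only: descent ddiff_mult_right)
  next
    case 2
    then show ?thesis
      using monk_op_rt_right[OF assms(1) N assms(3,4)] hyp[of i] hyp[of "Suc i"] assms
      by (simp add: descent ddiff_mult_left) (simp add: algebra_simps)
  next
    case 3
    then show ?thesis
      using monk_op_rt_above[OF 3 N assms(4)] hyp[of k] assms
      by (simp add: descent ddiff_scale)
  next
    case 4
    then show ?thesis
      using monk_op_rt_below[OF assms(1) 4 assms(4)] hyp[of k] assms
      by (simp add: descent ddiff_scale)
  qed
qed

end

subsection \<open>Existence and uniqueness of the double Grothendieck polynomials\<close>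

lemma sx_prod: "sx i (prod f A) = (\<Prod>a\<in>A. sx i (f a))"
  by (induction A rule: infinite_finite_induct) simp_all

text \<open>Chosen so that 1 + beta \<open>box i j\<close> = (1 + beta x_i)(1 + beta y_j), which is
  what settles the base case of the formula.\<close>

definition box :: "nat \<Rightarrow> nat \<Rightarrow> gring" where
  "box i j = xv i + yv j + beta * xv i * yv j"

definition boxes :: "(nat \<Rightarrow> nat) \<Rightarrow> nat \<Rightarrow> gring" where
  "boxes c N = (\<Prod>i=1..N. \<Prod>j=1..c i. box i j)"

lemma boxes_cong: "(\<And>i. 0 < i \<Longrightarrow> i \<le> N \<Longrightarrow> c i = d i) \<Longrightarrow> boxes c N = boxes d N"
  unfolding boxes_def by (intro prod.cong) auto

lemma boxes_Suc_0: "c (Suc N) = 0 \<Longrightarrow> boxes c (Suc N) = boxes c N"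
  by (simp add: boxes_def)

lemma staircase:
  "(\<Prod>(i, j)\<in>{(i, j). 1 \<le> i \<and> i \<le> n - 1 \<and> 1 \<le> j \<and> j \<le> n - 1 \<and> i + j \<le> n}.
      xv i + yv j + beta * xv i * yv j) = boxes (\<lambda>i. n - i) n"
proof -
  have "{(i, j). 1 \<le> i \<and> i \<le> n - 1 \<and> 1 \<le> j \<and> j \<le> n - 1 \<and> i + j \<le> n}
      = Sigma {1..n} (\<lambda>i. {1..n - i})"
    by auto
  then show ?thesis
    by (simp add: boxes_def prod.Sigma box_def)
qed

lemma boxes_split:
  assumes "0 < i" "i \<le> N" "c i = Suc d"
  shows "boxes c N = boxes (c(i := d)) N * box i (Suc d)"
proof -
  have i: "i \<in> {1..N}" using assms by auto
  have rest: "(\<Prod>m\<in>{1..N} - {i}. \<Prod>j=1..(c(i := d)) m. box m j)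
      = (\<Prod>m\<in>{1..N} - {i}. \<Prod>j=1..c m. box m j)"
    by (intro prod.cong) auto
  show ?thesis
    unfolding boxes_def prod.remove[OF finite_atLeastAtMost i] rest using assms(3)
    by (simp add: mult_ac)
qed

lemma sx_box: "sx i (box m j) = box (transpose i (Suc i) m) j"
  by (simp add: box_def sx_xv)

lemma sx_boxes:
  assumes "0 < i" "Suc i \<le> N" "c (Suc i) = c i"
  shows "sx i (boxes c N) = boxes c N"
proof -
  let ?t = "transpose i (Suc i)"
  have "sx i (boxes c N) = (\<Prod>m=1..N. \<Prod>j=1..c (?t m). box (?t m) j)"
    unfolding boxes_def sx_prod sx_box using assms(3)
    by (intro prod.cong refl) (auto simp: transpose_def)
  also have "\<dots> = boxes c N"
    unfolding boxes_def using assms(1,2)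
    by (intro prod.reindex_bij_betw[of ?t "{1..N}" "{1..N}" "\<lambda>m. \<Prod>j=1..c m. box m j"])
      (intro bij_betwI[where g = ?t]; auto simp: transpose_def)
  finally show ?thesis .
qed

lemma ddiff_box: "ddiff i (box i j) = 1"
  by (rule ddiff_eqI) (simp add: box_def algebra_simps)

text \<open>Without the last box of row i the rows i and i + 1 are equally long and their product is
  symmetric. So pi_i sees only that box, which it sends to 1.\<close>

lemma ddiff_boxes:
  assumes "0 < i" "Suc i \<le> N" "c i = Suc (c (Suc i))"
  shows "ddiff i (boxes c N) = boxes (c(i := c (Suc i))) N"
proof -
  have "sx i (boxes (c(i := c (Suc i))) N) = boxes (c(i := c (Suc i))) N"
    using assms by (intro sx_boxes) auto
  moreover have "boxes c N = boxes (c(i := c (Suc i))) N * box i (Suc (c (Suc i)))"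
    using assms by (intro boxes_split) auto
  ultimately show ?thesis
    by (simp add: ddiff_scale ddiff_box)
qed

definition move_entry :: "(nat \<Rightarrow> nat) \<Rightarrow> nat \<Rightarrow> nat \<Rightarrow> nat \<Rightarrow> nat" where
  "move_entry w l m i = (if l \<le> i \<and> i < m then w (Suc i) else if i = m then w l else w i)"

lemma move_entry_refl: "move_entry w l l = w"
  by (auto simp: move_entry_def)

lemma move_entry_Suc: "l \<le> m \<Longrightarrow> move_entry w l (Suc m) = rt (move_entry w l m) m (Suc m)"
  by (auto simp: move_entry_def rt_apply transpose_def fun_eq_iff)

text \<open>
  Moving the entry at position \<open>l\<close> to position \<open>m\<close> by adjacent swaps
  removes one box from each of the rows $l, \dots, m - 1$. The permutations that occur are
  dominant, so their polynomials are products.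
\<close>

lemma boxes_move_entry:
  assumes G: "\<And>v i. v \<in> Sn N \<Longrightarrow> 0 < i \<Longrightarrow> Suc i \<le> N \<Longrightarrow> v (Suc i) < v i \<Longrightarrow> G (rt v i (Suc i))
      = ddiff i (G v)"
    and w: "w \<in> Sn N" "G w = boxes c N" and lm: "0 < l" "l \<le> m" "m \<le> N"
    and gt: "\<And>i. l < i \<Longrightarrow> i \<le> m \<Longrightarrow> w i < w l"
    and c: "\<And>i. l \<le> i \<Longrightarrow> i < m \<Longrightarrow> c i = Suc (c (Suc i))"
  shows "move_entry w l m \<in> Sn N \<and> G (move_entry w l m) = boxes (\<lambda>i. if l \<le> i
      \<and> i < m then c i - 1 else c i) N"
  using lm(2,3) gt c
proof (induction m rule: dec_induct)
  case base
  have "(\<lambda>i. if l \<le> i \<and> i < l then c i - 1 else c i) = c" by auto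
  then show ?case using w by (simp add: move_entry_refl)
next
  case (step m)
  let ?c = "\<lambda>m i. if l \<le> i \<and> i < m then c i - 1 else c i"
  have IH: "move_entry w l m \<in> Sn N" "G (move_entry w l m) = boxes (?c m) N"
    using step by auto
  have "move_entry w l m (Suc m) < move_entry w l m m"
    using step by (simp add: move_entry_def)
  then have "G (move_entry w l (Suc m)) = ddiff m (boxes (?c m) N)"
    using G[of "move_entry w l m" m] IH lm(1) step by (simp add: move_entry_Suc)
  also have "\<dots> = boxes ((?c m)(m := ?c m (Suc m))) N"
    using lm(1) step by (intro ddiff_boxes) auto
  also have "(?c m)(m := ?c m (Suc m)) = ?c (Suc m)"
    using step.hyps step.prems(3)[of m] by (auto simp: fun_eq_iff)
  finally show ?case
    using IH(1) lm(1) step by (simp add: move_entry_Suc Sn_rt)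
qed

lemma w0_in: "0 < i \<Longrightarrow> i \<le> n \<Longrightarrow> w0 n i = Suc n - i"
  and w0_out: "n < i \<Longrightarrow> w0 n i = i"
  by (simp_all add: w0_def)

lemma move_entry_w0: "move_entry (w0 (Suc n)) 1 (Suc n) = w0 n"
  by (auto simp: move_entry_def w0_def fun_eq_iff)

text \<open>Once n + 1 has been carried to position k, position k + 1 holds n + 1 - k, the old entry
  of \<open>w0 n\<close> at k; carrying that to the end completes the swap.\<close>

lemma move_entry_move_entry_w0:
  assumes "0 < k" "k \<le> n"
  shows "move_entry (move_entry (w0 (Suc n)) 1 k) (Suc k) (Suc n) = rt (w0 n) k (Suc n)"
  using assms by (auto simp: move_entry_def w0_def rt_apply transpose_def fun_eq_iff)

text \<open>
  The choice of the least ascent is immaterial, by a diamond argument that uses the commutation and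
  braid relations of the divided differences.
\<close>

function groth_n :: "nat \<Rightarrow> (nat \<Rightarrow> nat) \<Rightarrow> gring" where
  "groth_n n w = (if w \<in> Sn n \<and> w \<noteq> w0 n
     then ddiff (LEAST i. 0 < i \<and> i < n \<and> w i < w (Suc i))
       (groth_n n (rt w (LEAST i. 0 < i \<and> i < n \<and> w i < w (Suc i)) (Suc (LEAST i. 0 < i \<and> i < n
           \<and> w i < w (Suc i)))))
     else boxes (\<lambda>i. n - i) n)"
  by pat_completeness auto

lemma Sn_rt_adj: "w \<in> Sn n \<Longrightarrow> 0 < i \<Longrightarrow> i < n \<Longrightarrow> rt w i (Suc i) \<in> Sn n"
  by (rule Sn_rt) auto

lemma colen_rt:
  assumes "w \<in> Sn n" "0 < i" "i < n" "w i < w (Suc i)"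
  shows "n * n - len (rt w i (Suc i)) < n * n - len w"
  using len_rt_ascent[OF Sn_Sinf[OF assms(1)] assms(2,4)] len_le[OF Sn_rt_adj[OF assms(1-3)]]
      by simp

termination groth_n
proof (relation "measure (\<lambda>(n, w). n * n - len w)")
  fix n w assume "w \<in> Sn n \<and> w \<noteq> w0 n"
  moreover from this have "\<exists>i. 0 < i \<and> i < n \<and> w i < w (Suc i)" using Sn_ascent by blast
  from LeastI_ex[OF this] calculation
  show "((n, rt w (LEAST i. 0 < i \<and> i < n \<and> w i < w (Suc i)) (Suc (LEAST i. 0 < i \<and> i < n
      \<and> w i < w (Suc i)))), (n, w))
      \<in> measure (\<lambda>(n, w). n * n - len w)"
    by (auto intro!: colen_rt)
qed simp

declare groth_n.simps [simp del]

lemma groth_n_w0: "groth_n n (w0 n) = boxes (\<lambda>i. n - i) n"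
  by (simp add: groth_n.simps)

text \<open>Both routes climb to a common permutation: by one further swap each if the ascents are
  far apart, and by two each if they are adjacent, where three consecutive entries get
  reversed.\<close>

lemma groth_n_diamond:
  assumes IH: "\<And>v l. n * n - len v < n * n - len w \<Longrightarrow> v \<in> Sn n \<Longrightarrow> 0 < l \<Longrightarrow> l < n \<Longrightarrow> v l < v (Suc l)
      \<Longrightarrow> groth_n n v = ddiff l (groth_n n (rt v l (Suc l)))"
    and w: "w \<in> Sn n" and i: "0 < i" "w i < w (Suc i)" and j: "i < j" "j < n" "w j < w (Suc j)"
  shows "ddiff i (groth_n n (rt w i (Suc i))) = ddiff j (groth_n n (rt w j (Suc j)))"
proof -
  have ij: "i < n" "0 < j" using i j by auto
  note u = Sn_rt_adj[OF w i(1) ij(1)] colen_rt[OF w i(1) ij(1) i(2)]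
  note v = Sn_rt_adj[OF w ij(2) j(2)] colen_rt[OF w ij(2) j(2,3)]
  show ?thesis
  proof (cases "j = Suc i")
    case False
    then have "Suc i < j" using j by simp
    then have "groth_n n (rt w i (Suc i)) = ddiff j (groth_n n (rt (rt w i (Suc i)) j (Suc j)))"
      and "groth_n n (rt w j (Suc j)) = ddiff i (groth_n n (rt (rt w j (Suc j)) i (Suc i)))"
      using IH[OF u(2,1) ij(2) j(2)] IH[OF v(2,1) i(1) ij(1)] i j by simp_all
    moreover have "rt (rt w i (Suc i)) j (Suc j) = rt (rt w j (Suc j)) i (Suc i)"
      using \<open>Suc i < j\<close> by (intro rt_commute) auto
    ultimately show ?thesis
      by (simp only: ddiff_commute[OF \<open>Suc i < j\<close>])
  next
    case True
    let ?u = "rt w i (Suc i)" and ?v = "rt w (Suc i) (Suc (Suc i))"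
    let ?u2 = "rt ?u (Suc i) (Suc (Suc i))" and ?v2 = "rt ?v i (Suc i)"
    have asc: "?u (Suc i) < ?u (Suc (Suc i))" "?v i < ?v (Suc i)" "?u2 i < ?u2 (Suc i)" "?v2 (Suc i) < ?v2 (Suc (Suc i))"
      using i j True by auto
    have n: "Suc i < n" using True j by simp
    have u2: "?u2 \<in> Sn n" "n * n - len ?u2 < n * n - len ?u"
      using Sn_rt_adj[OF u(1), of "Suc i"] colen_rt[OF u(1), of "Suc i"] asc n by auto
    have v2: "?v2 \<in> Sn n" "n * n - len ?v2 < n * n - len ?v"
      using Sn_rt_adj[OF v(1), of i] colen_rt[OF v(1), of i] asc n i True by auto
    have "groth_n n ?u = ddiff (Suc i) (groth_n n ?u2)" "groth_n n ?v = ddiff i (groth_n n ?v2)"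
      using IH[OF u(2,1), of "Suc i"] IH[OF v(2,1), of i] asc n i True by auto
    moreover have "groth_n n ?u2 = ddiff i (groth_n n (rt ?u2 i (Suc i)))"
      using IH[OF _ u2(1), of i] u(2) u2(2) asc n i by simp
    moreover have "groth_n n ?v2 = ddiff (Suc i) (groth_n n (rt ?v2 (Suc i) (Suc (Suc i))))"
      using IH[OF _ v2(1), of "Suc i"] v(2) v2(2) asc n i True by simp
    moreover have "rt ?u2 i (Suc i) = rt ?v2 (Suc i) (Suc (Suc i))"
      by (auto simp: rt_def transpose_def fun_eq_iff)
    ultimately show ?thesis
      by (simp add: True ddiff_braid)
  qed
qed

lemma groth_n_ascent:
  assumes "w \<in> Sn n" "0 < i" "i < n" "w i < w (Suc i)"
  shows "groth_n n w = ddiff i (groth_n n (rt w i (Suc i)))"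
  using assms
proof (induction "n * n - len w" arbitrary: w i rule: less_induct)
  case less
  define j where "j = (LEAST i. 0 < i \<and> i < n \<and> w i < w (Suc i))"
  have "0 < j \<and> j < n \<and> w j < w (Suc j)"
    unfolding j_def by (rule LeastI[of _ i]) (use less.prems in auto)
  then have j: "0 < j" "j < n" "w j < w (Suc j)" by auto
  have "j \<le> i" unfolding j_def by (rule Least_le) (use less.prems in auto)
  have "w \<noteq> w0 n" using less.prems by (auto simp: w0_def)
  then have "groth_n n w = ddiff j (groth_n n (rt w j (Suc j)))"
    using less.prems(1) by (subst groth_n.simps) (simp add: j_def)
  also have "\<dots> = ddiff i (groth_n n (rt w i (Suc i)))"
  proof (cases "j = i")
    case False
    then show ?thesis
      using \<open>j \<le> i\<close> less j by (intro groth_n_diamond) auto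
  qed simp
  finally show ?case .
qed

lemma groth_n_descent:
  assumes "w \<in> Sn n" "0 < i" "i < n" "w (Suc i) < w i"
  shows "groth_n n (rt w i (Suc i)) = ddiff i (groth_n n w)"
  using groth_n_ascent[of "rt w i (Suc i)" n i] assms by (simp add: Sn_rt_adj)

text \<open>Carrying n + 1 from the front of \<open>w0 (Suc n)\<close> to the end removes one box
  from each of the first n rows and leaves the staircase of \<open>w0 n\<close>. From there on both
  recursions agree.\<close>

lemma groth_n_Suc: "w \<in> Sn n \<Longrightarrow> groth_n (Suc n) w = groth_n n w"
proof (induction w rule: Sn_induct)
  case w0
  have "groth_n (Suc n) (move_entry (w0 (Suc n)) 1 (Suc n))
      = boxes (\<lambda>i. if 1 \<le> i \<and> i < Suc n then (Suc n - i) - 1 else Suc n - i) (Suc n)"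
    by (rule conjunct2[OF boxes_move_entry]) (auto simp: groth_n_w0 groth_n_descent w0_in)
  also have "\<dots> = boxes (\<lambda>i. n - i) (Suc n)"
    by (rule boxes_cong) auto
  finally show ?case
    unfolding move_entry_w0 by (simp add: groth_n_w0 boxes_Suc_0)
next
  case (step w i)
  then show ?case using Sn_mono[of w n "Suc n"] by (simp add: groth_n_descent)
qed

lemma groth_n_mono: "m \<le> n \<Longrightarrow> w \<in> Sn m \<Longrightarrow> groth_n n w = groth_n m w"
  by (induction n rule: dec_induct) (simp_all add: groth_n_Suc Sn_mono)

definition groth_stable :: "(nat \<Rightarrow> nat) \<Rightarrow> gring" where
  "groth_stable w = (if w \<in> Sinf then groth_n (LEAST n. w \<in> Sn n) w else 0)"

lemma groth_stable_eq: "w \<in> Sn n \<Longrightarrow> groth_stable w = groth_n n w"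
  using groth_n_mono[of "LEAST n. w \<in> Sn n" n w] LeastI[of "\<lambda>n. w \<in> Sn n" n] Least_le[of "\<lambda>n. w \<in> Sn n" n]
  by (simp add: groth_stable_def Sn_Sinf)

lemma is_groth_iff: "is_groth G \<longleftrightarrow> (\<forall>w. w \<notin> Sinf \<longrightarrow> G w = 0) \<and> (\<forall>n\<ge>1. G (w0 n) = boxes (\<lambda>i. n - i) n)
    \<and> (\<forall>w\<in>Sinf. \<forall>i\<ge>1. w (Suc i) < w i \<longrightarrow> G (rt w i (Suc i)) = ddiff i (G w))"
proof -
  have "(xv i - xv (i + 1)) * g = (1 + beta * xv (i + 1)) * f - (1 + beta * xv i) * sx i f \<longleftrightarrow> g
      = ddiff i f" for i f g
    using ddiff_eqI[of i g f] ddiff[of i f] by auto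
  then show ?thesis unfolding is_groth_def staircase by simp
qed

lemma is_groth_groth_stable: "is_groth groth_stable"
proof -
  have "groth_stable (rt w i (Suc i)) = ddiff i (groth_stable w)" if w: "w \<in> Sinf" "1 \<le> i"
      "w (Suc i) < w i" for w i
  proof -
    obtain m where "w \<in> Sn m" using Sinf_Sn w by blast
    then have m: "w \<in> Sn (m + Suc i)" by (rule Sn_mono) simp
    have "groth_stable (rt w i (Suc i)) = groth_n (m + Suc i) (rt w i (Suc i))"
      using m w by (intro groth_stable_eq Sn_rt_adj) auto
    then show ?thesis using m w by (simp add: groth_n_descent groth_stable_eq)
  qed
  moreover have "groth_stable w = 0" if "w \<notin> Sinf" for w
    using that by (simp add: groth_stable_def)
  ultimately show ?thesis
    unfolding is_groth_iff by (simp add: groth_stable_eq[OF w0_Sn] groth_n_w0)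
qed

lemma is_groth_unique:
  assumes "is_groth G"
  shows "G = groth_stable"
proof
  fix w
  show "G w = groth_stable w"
  proof (cases "w \<in> Sinf")
    case True
    then obtain m where "w \<in> Sn m" using Sinf_Sn by blast
    \<comment> \<open>The normalisation in \<open>is_groth\<close> covers only n at least 1.\<close>
    then have "w \<in> Sn (Suc m)" by (rule Sn_mono) simp
    then show ?thesis
    proof (induction w rule: Sn_induct)
      case w0
      then show ?case using assms by (simp add: is_groth_iff groth_stable_eq[OF w0_Sn] groth_n_w0)
    next
      case (step w i)
      then show ?case
        using assms is_groth_groth_stable Sn_Sinf[OF step(1)] by (simp add: is_groth_iff)
    qed
  next
    case False
    then show ?thesis using assms by (simp add: is_groth_iff groth_stable_def)
  qed
qed

lemma is_groth_groth: "is_groth groth"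
  unfolding groth_def by (rule theI[of _ groth_stable]) (simp_all add: is_groth_groth_stable is_groth_unique)

lemma groth_w0: "groth (w0 (Suc n)) = boxes (\<lambda>i. Suc n - i) (Suc n)"
  and groth_descent: "w \<in> Sinf \<Longrightarrow> 0 < i \<Longrightarrow> w (Suc i) < w i \<Longrightarrow> groth (rt w i (Suc i))
      = ddiff i (groth w)"
  and groth_notin: "w \<notin> Sinf \<Longrightarrow> groth w = 0"
  using is_groth_groth by (auto simp: is_groth_iff)

text \<open>Outside \<open>Sinf\<close> both sides vanish, since a swap of positive positions does
  not change membership.\<close>

lemma ddiff_family_groth:
  assumes "0 < i"
  shows "ddiff_family groth i"
proof
  fix w :: "nat \<Rightarrow> nat"
  show "groth w = 0" if "\<not> inj w" using that Sinf_inj by (auto intro: groth_notin)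
  show "groth (rt w i (Suc i)) = ddiff i (groth w)" if "w (Suc i) < w i"
    using that assms by (cases "w \<in> Sinf") (simp_all add: groth_descent groth_notin Sinf_rt_iff)
qed

text \<open>Starting from the staircase of \<open>w0 (Suc n)\<close>, the first move shortens the
  rows above k and the second those below k. Only row k keeps its length, one box more than in the
  staircase of \<open>w0 n\<close>.\<close>

lemma groth_rt_w0:
  assumes "0 < k" "k \<le> n"
  shows "groth (rt (w0 n) k (Suc n)) = groth (w0 n) * box k (Suc n - k)"
proof -
  let ?N = "Suc n"
  let ?c = "\<lambda>i. if 1 \<le> i \<and> i < k then ?N - i - 1 else ?N - i"
  let ?d = "\<lambda>i. if Suc k \<le> i \<and> i < ?N then ?c i - 1 else ?c i"
  let ?v = "move_entry (w0 ?N) 1 k"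
  have G: "groth (rt v i (Suc i)) = ddiff i (groth v)"
    if "v \<in> Sn ?N" "0 < i" "Suc i \<le> ?N" "v (Suc i) < v i" for v i
    using that by (simp add: groth_descent Sn_Sinf)
  have v: "?v \<in> Sn ?N \<and> groth ?v = boxes ?c ?N"
    using assms by (intro boxes_move_entry G) (auto simp: groth_w0 w0_in)
  have gt: "?v i < ?v (Suc k)" if "Suc k < i" "i \<le> ?N" for i
    using that assms by (simp add: move_entry_def w0_in)
  have "move_entry ?v (Suc k) ?N \<in> Sn ?N \<and> groth (move_entry ?v (Suc k) ?N) = boxes ?d ?N"
    using v assms gt by (intro boxes_move_entry G) auto
  then have 1: "groth (rt (w0 n) k ?N) = boxes ?d ?N"
    unfolding move_entry_move_entry_w0[OF assms] ..
  have 2: "boxes ?d ?N = boxes (?d(k := n - k)) ?N * box k (Suc (n - k))"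
    using assms by (intro boxes_split) auto
  have 3: "boxes (?d(k := n - k)) ?N = boxes (\<lambda>i. n - i) ?N"
    by (rule boxes_cong) auto
  have "groth (w0 n) = boxes (\<lambda>i. n - i) n"
    using assms groth_w0[of "n - 1"] by simp
  then show ?thesis
    unfolding 1 2 3 using assms by (simp add: boxes_Suc_0 Suc_diff_le)
qed

subsection \<open>The formula in operator form\<close>

lemma bruhat_prod_no_cov: "(\<And>a b. (a, b) \<in> set ps \<Longrightarrow> \<not> cov w a b) \<Longrightarrow> bruhat_prod c ps F w = F w"
proof (induction ps)
  case (Cons p ps)
  obtain a b where [simp]: "p = (a, b)" by force
  have "\<not> cov w a b" using Cons.prems[of a b] by simp
  moreover have "bruhat_prod c ps F w = F w" using Cons.prems by (intro Cons.IH) auto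
  ultimately show ?case by (simp add: bruhat_op_def)
qed simp

lemma monk_op_w0:
  assumes "0 < k" "k \<le> n"
  shows "monk_op (Suc n) k groth (w0 n) = (1 + beta * xv k) * groth (w0 n)"
proof -
  let ?U = "uppers k [Suc k..<Suc n]" and ?w = "rt (w0 n) k (Suc n)" and ?y = "yv (Suc n - k)"
  have U: "uppers k [Suc k..<Suc (Suc n)] = (k, Suc n) # ?U"
    using assms by simp
  have inj: "inj (w0 n)" using Sn_inj[OF w0_Sn] .
  have "bruhat_prod (- beta) (lowers k [1..<k]) F (w0 n) = F (w0 n)" for F
    using assms by (intro bruhat_prod_no_cov) (auto simp: cov_def w0_in)
  then have "monk_op (Suc n) k groth (w0 n)
      = finv (1 + beta * ?y) * bruhat_op beta k (Suc n) (bruhat_prod beta ?U groth) (w0 n)"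
    unfolding monk_op_def U weight_op_def using assms by (simp add: w0_in del: upt_Suc)
  also have "bruhat_prod beta ?U groth (w0 n) = groth (w0 n)"
    using assms by (intro bruhat_prod_no_cov) (auto simp: cov_def w0_in)
  then have "bruhat_op beta k (Suc n) (bruhat_prod beta ?U groth) (w0 n) = groth (w0 n) + beta
      * bruhat_prod beta ?U groth ?w"
    using assms inj by (auto simp: bruhat_op_def cov_def w0_in w0_out simp del: upt_Suc)
  \<comment> \<open>Position k now holds n + 1, which exceeds every entry at a position up to
    n.\<close>
  also have "bruhat_prod beta ?U groth ?w = groth ?w"
  proof (rule bruhat_prod_no_cov)
    fix a b assume "(a, b) \<in> set ?U"
    then have "a = k" "k < b" "b \<le> n" by auto
    then show "\<not> cov ?w a b" using assms by (auto simp: cov_def w0_in w0_out)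
  qed
  also have "groth (w0 n) + beta * groth ?w = (1 + beta * ?y) * ((1 + beta * xv k) * groth (w0 n))"
    unfolding groth_rt_w0[OF assms] box_def by (simp add: algebra_simps)
  also have "finv (1 + beta * ?y) * \<dots>
      = ((1 + beta * ?y) * finv (1 + beta * ?y)) * ((1 + beta * xv k) * groth (w0 n))"
    by (simp only: mult.assoc mult.left_commute)
  finally show ?thesis unfolding finv_mult by simp
qed

lemma monk_op_groth:
  assumes "w \<in> Sn n" "0 < k" "k \<le> n"
  shows "monk_op (Suc n) k groth w = (1 + beta * xv k) * groth w"
  using assms
proof (induction w arbitrary: k rule: Sn_induct)
  case w0
  then show ?case by (rule monk_op_w0)
next
  case (step w i)
  then interpret ddiff_family groth i by (intro ddiff_family_groth)
  show ?case
    using step Sn_inj[OF step(1)] by (intro monk_op_step) auto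
qed

subsection \<open>Sums over chains\<close>

fun bruhat_chain :: "(nat \<Rightarrow> nat) \<Rightarrow> (nat \<times> nat) list \<Rightarrow> bool" where
  "bruhat_chain u [] \<longleftrightarrow> True"
| "bruhat_chain u ((a, b) # ps) \<longleftrightarrow> cov u a b \<and> bruhat_chain (rt u a b) ps"

fun chain_target :: "(nat \<Rightarrow> nat) \<Rightarrow> (nat \<times> nat) list \<Rightarrow> nat \<Rightarrow> nat" where
  "chain_target u [] = u"
| "chain_target u ((a, b) # ps) = chain_target (rt u a b) ps"

lemma bruhat_chain_append: "bruhat_chain u (ps @ qs) \<longleftrightarrow> bruhat_chain u ps
    \<and> bruhat_chain (chain_target u ps) qs"
  by (induction u ps rule: bruhat_chain.induct) auto

lemma chain_target_append: "chain_target u (ps @ qs) = chain_target (chain_target u ps) qs"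
  by (induction u ps rule: bruhat_chain.induct) auto

lemma chain_target_foldl: "foldl (\<circ>) u (map (\<lambda>(a, b). transpose a b) ps) = chain_target u ps"
  by (induction u ps rule: bruhat_chain.induct) (simp_all add: rt_def del: comp_apply)

lemma chain_target_Sn:
  "u \<in> Sn n \<Longrightarrow> (\<And>a b. (a, b) \<in> set ps \<Longrightarrow> 0 < a \<and> 0 < b \<and> a \<le> n \<and> b \<le> n) \<Longrightarrow> chain_target u ps \<in> Sn n"
proof (induction u ps rule: bruhat_chain.induct)
  case (2 u a b ps)
  have "rt u a b \<in> Sn n" using 2(2) 2(3)[of a b] by (simp add: Sn_rt)
  moreover have "0 < a \<and> 0 < b \<and> a \<le> n \<and> b \<le> n" if "(a, b) \<in> set ps" for a b
    using that 2(3)[of a b] by simp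
  ultimately show ?case using 2(1) by simp
qed simp

text \<open>Peeling off the first step turns the indexed length conditions into the recursion of
  \<open>bruhat_chain\<close>.\<close>

lemma bruhat_chain_iff_len:
  assumes "u \<in> Sinf" "\<And>a b. (a, b) \<in> set ps \<Longrightarrow> 0 < a \<and> a < b"
  shows "(\<forall>i<length ps. len (foldl (\<circ>) u (take (Suc i) (map (\<lambda>(a, b). transpose a b) ps)))
      = len (foldl (\<circ>) u (take i (map (\<lambda>(a, b). transpose a b) ps))) + 1) \<longleftrightarrow> bruhat_chain u ps"
  using assms
proof (induction u ps rule: bruhat_chain.induct)
  case (2 u a b ps)
  have ab: "0 < a" "a < b" using 2(3)[of a b] by auto
  then have "rt u a b \<in> Sinf" using 2(2) by (intro Sinf_rt) auto
  then have "(\<forall>i<length ps. len (foldl (\<circ>) (rt u a b) (take (Suc i) (map (\<lambda>(a, b). transpose a b) ps)))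
      = len (foldl (\<circ>) (rt u a b) (take i (map (\<lambda>(a, b). transpose a b) ps))) + 1)
          \<longleftrightarrow> bruhat_chain (rt u a b) ps"
    using 2(3) by (intro 2(1)) auto
  then show ?case
    using cov_iff_len[OF 2(2) ab] by (simp add: All_less_Suc2 del: comp_apply flip: rt_def)
qed simp

text \<open>The half-open interval serves both parts of a chain: from 0 to k - 1 for the lower
  positions and from k to n + 1 for the upper ones.\<close>

definition desc_lists :: "nat \<Rightarrow> nat \<Rightarrow> nat list set" where
  "desc_lists l m = {as. sorted_wrt (>) as \<and> set as \<subseteq> {l<..m}}"

lemma desc_lists_self: "desc_lists l l = {[]}"
  by (auto simp: desc_lists_def)

lemma desc_lists_Suc:
  assumes "l \<le> m"
  shows "desc_lists l (Suc m) = desc_lists l m \<union> Cons (Suc m) ` desc_lists l m"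
proof (intro equalityI subsetI)
  fix as assume as: "as \<in> desc_lists l (Suc m)"
  show "as \<in> desc_lists l m \<union> Cons (Suc m) ` desc_lists l m"
  proof (cases as)
    case Nil
    then show ?thesis by (simp add: desc_lists_def)
  next
    case (Cons a bs)
    then have bs: "bs \<in> desc_lists l (a - 1)" and a: "l < a" "a \<le> Suc m"
      using as by (fastforce simp: desc_lists_def)+
    then show ?thesis
      using as unfolding Cons by (cases "a = Suc m") (force simp: desc_lists_def)+
  qed
qed (use assms in \<open>auto simp: desc_lists_def subset_iff less_Suc_eq_le\<close>)

lemma finite_desc_lists: "l \<le> m \<Longrightarrow> finite (desc_lists l m)"
  by (induction m rule: dec_induct) (simp_all add: desc_lists_self desc_lists_Suc)

text \<open>Expanding the product selects some of its factors. The outermost one belongs to the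
  largest position and is the first step, so the selections are exactly the decreasing
  lists.\<close>

lemma bruhat_prod_sum:
  assumes "l \<le> m"
  shows "bruhat_prod c (map f (rev [Suc l..<Suc m])) F u
    = (\<Sum>as\<in>{as\<in>desc_lists l m. bruhat_chain u (map f as)}. c ^ length as
        * F (chain_target u (map f as)))"
  using assms
proof (induction m arbitrary: u rule: dec_induct)
  case base
  have "{as \<in> desc_lists l l. bruhat_chain u (map f as)} = {[]}" by (auto simp: desc_lists_self)
  then show ?case by simp
next
  case (step m)
  obtain a b where ab: "f (Suc m) = (a, b)" by force
  let ?S = "\<lambda>u. {as \<in> desc_lists l m. bruhat_chain u (map f as)}"
  let ?g = "\<lambda>u as. c ^ length as * F (chain_target u (map f as))"
  let ?T = "if cov u a b then Cons (Suc m) ` ?S (rt u a b) else {}"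
  have fin: "finite (?S v)" for v using finite_desc_lists[of l m] step by simp
  have "{as \<in> desc_lists l (Suc m). bruhat_chain u (map f as)} = ?S u \<union> ?T"
    using step by (auto simp: desc_lists_Suc ab)
  moreover have "?S u \<inter> ?T = {}"
    by (auto simp: desc_lists_def)
  moreover have "finite ?T" using fin by simp
  ultimately have "(\<Sum>as\<in>{as\<in>desc_lists l (Suc m). bruhat_chain u (map f as)}. ?g u as)
      = sum (?g u) (?S u) + sum (?g u) ?T"
    using fin[of u] by (simp only: sum.union_disjoint)
  also have "sum (?g u) ?T = (if cov u a b then c * sum (?g (rt u a b)) (?S (rt u a b)) else 0)"
    by (simp add: sum.reindex ab sum_distrib_left mult.assoc)
  finally show ?case
    using step by (simp add: ab bruhat_op_def)
qed

text \<open>Each swap brings to position k an entry not moved before, because the positions are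
  distinct; so the last swap decides. This identifies the weight in the formula.\<close>

lemma chain_target_lowers:
  "sorted_wrt (>) as \<Longrightarrow> k \<notin> set as \<Longrightarrow> chain_target u (map (\<lambda>a. (a, k)) as) k = u (last_a k as)"
proof (induction as arbitrary: u)
  case (Cons a as)
  then have IH: "chain_target (rt u a k) (map (\<lambda>a. (a, k)) as) k = rt u a k (last_a k as)" by auto
  show ?case
  proof (cases "as = []")
    case False
    then have "last as \<in> set as" by simp
    then have "last as \<noteq> a" "last as \<noteq> k" using Cons.prems by auto
    then show ?thesis using False IH by (simp add: last_a_def)
  qed (simp add: last_a_def)
qed (simp add: last_a_def)

text \<open>A first step beyond n + 1 would jump over the fixed point n + 1, whose value lies
  between the two exchanged ones. Later positions are smaller still.\<close>

lemma bruhat_chain_uppers_bound: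
  assumes "w \<in> Sn n" "k \<le> n" "bruhat_chain w (map (\<lambda>b. (k, b)) bs)" "sorted_wrt (>) bs" "b \<in> set bs"
  shows "b \<le> Suc n"
proof -
  obtain b' bs' where bs: "bs = b' # bs'" using assms(5) by (cases bs) auto
  have cov: "cov w k b'" using assms(3) by (simp add: bs)
  have "b' \<le> Suc n"
  proof (rule ccontr)
    assume "\<not> b' \<le> Suc n"
    then have "w b' = b'" "w (Suc n) = Suc n" "w k \<le> n"
      using assms(1,2) by (auto simp: Sn_fix Sn_image)
    then show False using cov \<open>\<not> b' \<le> Suc n\<close> assms(2) unfolding cov_def
      by (metis le_imp_less_Suc not_le)
  qed
  moreover have "b \<le> b'" using assms(4,5) by (auto simp: bs)
  ultimately show ?thesis by simp
qed

lemma chain_perm_chain_target: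
  "chain_perm u k as bs i
    = foldl (\<circ>) u (take i (map (\<lambda>(a, b). transpose a b) (map (\<lambda>a. (a, k)) as @ map (\<lambda>b. (k, b)) bs)))"
  by (simp add: chain_perm_def chain_steps_def comp_def)

lemma chain_end_chain_target:
  "chain_end u k as bs = chain_target (chain_target u (map (\<lambda>a. (a, k)) as)) (map (\<lambda>b. (k, b)) bs)"
proof -
  have "chain_end u k as bs = foldl (\<circ>) u (map (\<lambda>(a, b). transpose a b) (map (\<lambda>a. (a, k)) as @ map (\<lambda>b. (k, b)) bs))"
    unfolding chain_end_def chain_perm_chain_target by simp
  then show ?thesis unfolding chain_target_foldl chain_target_append .
qed

lemma chains_eq:
  assumes u: "u \<in> Sn n" and k: "0 < k" "k \<le> n"
  shows "chains u k = Sigma {as \<in> desc_lists 0 (k - 1). bruhat_chain u (map (\<lambda>a. (a, k)) as)}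
    (\<lambda>as. {bs \<in> desc_lists k (Suc n). bruhat_chain (chain_target u (map (\<lambda>a. (a, k)) as)) (map (\<lambda>b. (k, b)) bs)})"
proof -
  have "(as, bs) \<in> chains u k \<longleftrightarrow> as \<in> desc_lists 0 (k - 1) \<and> bruhat_chain u (map (\<lambda>a. (a, k)) as)
      \<and> bs \<in> desc_lists k (Suc n)
          \<and> bruhat_chain (chain_target u (map (\<lambda>a. (a, k)) as)) (map (\<lambda>b. (k, b)) bs)" for as bs
  proof -
    let ?A = "map (\<lambda>a. (a, k)) as" and ?B = "map (\<lambda>b. (k, b)) bs"
    have 1: "as \<in> desc_lists 0 (k - 1) \<longleftrightarrow> sorted_wrt (>) as \<and> (\<forall>a\<in>set as. 1 \<le> a \<and> a < k)"
      using k(1) by (fastforce simp: desc_lists_def)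
    have 2: "(\<forall>i<length as + length bs. len (chain_perm u k as bs (Suc i))
        = len (chain_perm u k as bs i) + 1)
        \<longleftrightarrow> bruhat_chain u ?A \<and> bruhat_chain (chain_target u ?A) ?B"
      if "as \<in> desc_lists 0 (k - 1)" "\<forall>b\<in>set bs. k < b"
    proof -
      have pos: "0 < a \<and> a < b" if "(a, b) \<in> set (?A @ ?B)" for a b
        using that \<open>as \<in> _\<close> \<open>\<forall>b\<in>set bs. k < b\<close> k(1) unfolding 1 by auto
      show ?thesis
        using bruhat_chain_iff_len[OF Sn_Sinf[OF u], of "?A @ ?B", OF pos]
        by (simp only: chain_perm_chain_target bruhat_chain_append length_append length_map)
    qed
    \<comment> \<open>\<open>chains\<close> puts no upper bound on the b's; the cover conditions
      imply it.\<close>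
    have 3: "bs \<in> desc_lists k (Suc n) \<longleftrightarrow> sorted_wrt (>) bs \<and> (\<forall>b\<in>set bs. k < b)"
      if "as \<in> desc_lists 0 (k - 1)" "bruhat_chain (chain_target u ?A) ?B"
    proof -
      have "chain_target u ?A \<in> Sn n"
        using u that(1) k unfolding 1 by (intro chain_target_Sn) auto
      from bruhat_chain_uppers_bound[OF this k(2) that(2)] show ?thesis
        by (auto simp: desc_lists_def)
    qed
    show ?thesis
      unfolding chains_def using 1 2 3 by auto
  qed
  then show ?thesis by auto
qed

theorem theorem4p2:
  fixes n k :: nat and u :: "nat \<Rightarrow> nat"
  assumes "n > 0" and "u \<in> Sn n" and "1 \<le> k" and "k \<le> n"
  shows "(1 + beta * xv k) * groth u =
    (\<Sum>(as, bs)\<in>chains u k.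
       (-1) ^ length as * finv (1 + beta * yv (u (last_a k as))) *
       beta ^ (length as + length bs) * groth (chain_end u k as bs))"
proof -
  let ?A = "map (\<lambda>a. (a, k))" and ?B = "map (\<lambda>b. (k, b))"
  let ?SA = "{as \<in> desc_lists 0 (k - 1). bruhat_chain u (?A as)}"
  let ?SB = "\<lambda>as. {bs \<in> desc_lists k (Suc n). bruhat_chain (chain_target u (?A as)) (?B bs)}"
  have k: "0 < k" and k': "Suc (k - 1) = k" and kN: "k \<le> Suc n" using assms by auto
  have fin: "finite ?SA" "finite (?SB as)" for as
    using finite_desc_lists[of 0 "k - 1"] finite_desc_lists[OF kN] by auto
  have "(1 + beta * xv k) * groth u = monk_op (Suc n) k groth u"
    using monk_op_groth[OF assms(2) k assms(4)] ..
  also have "\<dots> = (\<Sum>as\<in>?SA. (- beta) ^ length as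
      * weight_op k (bruhat_prod beta (uppers k [Suc k..<Suc (Suc n)]) groth) (chain_target u (?A as)))"
    unfolding monk_op_def One_nat_def
    by (rule bruhat_prod_sum[where l = 0 and m = "k - 1" and f = "\<lambda>a. (a, k)", OF le0, unfolded k',
          unfolded One_nat_def])
  also have "\<dots> = (\<Sum>as\<in>?SA. \<Sum>bs\<in>?SB as. (-1) ^ length as * finv (1 + beta * yv (u (last_a k as))) *
       beta ^ (length as + length bs) * groth (chain_end u k as bs))"
  proof (rule sum.cong[OF refl])
    fix as assume "as \<in> ?SA"
    then have "sorted_wrt (>) as" "k \<notin> set as"
      using k by (auto simp: desc_lists_def)
    then have last: "chain_target u (?A as) k = u (last_a k as)" by (rule chain_target_lowers)
    show "(- beta) ^ length as * weight_op k
        (bruhat_prod beta (uppers k [Suc k..<Suc (Suc n)]) groth) (chain_target u (?A as))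
      = (\<Sum>bs\<in>?SB as. (-1) ^ length as * finv (1 + beta * yv (u (last_a k as))) *
       beta ^ (length as + length bs) * groth (chain_end u k as bs))"
      \<comment> \<open>Here (- beta)^p is split into sign and power, and the weight is moved inside
        the sum over the upper parts.\<close>
      unfolding weight_op_def last bruhat_prod_sum[OF kN] sum_distrib_left chain_end_chain_target power_minus[of beta] power_add
      by (intro sum.cong refl) (simp only: mult_ac)
  qed
  also have "\<dots> = (\<Sum>(as, bs)\<in>chains u k. (-1) ^ length as * finv (1 + beta * yv (u (last_a k as))) *
       beta ^ (length as + length bs) * groth (chain_end u k as bs))"
    unfolding chains_eq[OF assms(2) k assms(4)] using fin by (intro sum.Sigma) auto
  finally show ?thesis .
qed

end
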